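(* Let $\mathbb{C}$ be a Cartesian closed differential category with a parametrized fixpoint operator $\mathbf{fix}$ satisfying the differential-fixpoint rule, and assume all the conditions listed in the context (hom-sets ordered by the natural order with truncated subtractions, compatible $\omega$-cpo enrichment, Taylor category, fixpoint combinator obtained by Scott iteration). (1) For every object $A$, the family of Newton approximants $\{\mathcal{Z}_n:(A\Rightarrow A)\to A\}_{n\in\omega}$ is an $\omega$-chain, its supremum $\mathcal{Z}:=\bigvee_n\mathcal{Z}_n$ satisfies $\mathcal{Z}=\mathcal{Y}$, and $\mathcal{Z}_n\le\mathcal{Y}$ for all $n$ (so the Newton approximants converge to the least fixpoint from below), where $\mathcal{Y}:(A\Rightarrow A)\to A$ is the fixpoint combinator. (2) Let $f:A\times X\to X$ be a map such that $f(0,0)=0$ and such that the second partial derivative of $f$ is nilpotent in its linear argument, i.e. there exists $p\ge 1$ such that for all $a,z,b$, $\left(\frac{\mathsf{d}f(a,v)}{\mathsf{d}v}(z)\right)^p\cdot b=0$. Then, for the distance $d$ induced by the Taylor monomials, the convergence rate is quadratic: for all $n$, $$d(\mathcal{Z}_{n+1}(f),\mathcal{Y}(f))\le\big(d(\mathcal{Z}_n(f),\mathcal{Y}(f))\big)^2,$$ where $\mathcal{Z}_n(f):A\to X$ are the Newton approximants of $f$ and $\mathcal{Y}(f):=\mathbf{fix}^X_A(f):A\to X$.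
   Context: A left additive category is a category whose hom-sets are commutative monoids $(+,0)$ with $(f+g)\circ x=f\circ x+g\circ x$ and $0\circ x=0$. A map $f$ is additive if $f\circ(x+y)=f\circ x+f\circ y$ and $f\circ 0=0$. A Cartesian left additive category is a left additive category with finite products (projections $\pi_j$, pairing $\langle -,\dots,-\rangle$) in which all projections are additive. A Cartesian differential category is a Cartesian left additive category $\mathbb{C}$ with a differential combinator: functions $\mathbf{D}:\mathbb{C}(A,B)\to\mathbb{C}(A\times A,B)$ such that: [CD.1] $\mathbf{D}[0]=0$, $\mathbf{D}[f+g]=\mathbf{D}[f]+\mathbf{D}[g]$; [CD.2] $\mathbf{D}[f]\circ\langle x,0\rangle=0$, $\mathbf{D}[f]\circ\langle x,y+z\rangle=\mathbf{D}[f]\circ\langle x,y\rangle+\mathbf{D}[f]\circ\langle x,z\rangle$; [CD.3] $\mathbf{D}[1_A]=\pi_2$, $\mathbf{D}[\pi_j]=\pi_j\circ\pi_2$; [CD.4] $\mathbf{D}[\langle f_1,\dots,f_n\rangle]=\langle\mathbf{D}[f_1],\dots,\mathbf{D}[f_n]\rangle$; [CD.5] $\mathbf{D}[g\circ f]=\mathbf{D}[g]\circ\langle f\circ\pi_1,\mathbf{D}[f]\rangle$; [CD.6] $\mathbf{D}[\mathbf{D}[f]]\circ\langle x,y,0,z\rangle=\mathbf{D}[f]\circ\langle x,z\rangle$; [CD.7] $\mathbf{D}[\mathbf{D}[f]]\circ\langle x,y,z,0\rangle=\mathbf{D}[\mathbf{D}[f]]\circ\langle x,z,y,0\rangle$.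 Term notation: $\frac{\mathsf{d}f(x)}{\mathsf{d}x}(a)\cdot b:=\mathbf{D}[f](a,b)$; elements $a,b,\dots$ are generalized elements (maps into the object). For $f:A\times X\to B$ the second partial derivative is $\frac{\mathsf{d}f(a,v)}{\mathsf{d}v}(x)\cdot y:=\mathbf{D}[f](a,x,0,y)$; it is linear (in particular additive) in $y$, and its $p$-th power means $p$-fold iteration in $y$. The $n$-th derivative $f^{(n)}:A\times A^n\to B$ of $f:A\to B$ is obtained by differentiating $n$ times with respect to the first (non-linear) argument; write $f^{(n)}(a,(b,\dots,b))=\frac{\mathsf{d}^nf(x)}{\mathsf{d}x^n}(a)\cdot(b,\dots,b)$. It is multilinear in its last $n$ arguments. $\mathbb{C}$ is a Cartesian closed differential category if it is moreover Cartesian closed (internal hom $A\Rightarrow B$, evaluation $\mathrm{eval}:(A\Rightarrow B)\times A\to B$) with $\mathbf{D}[\mathrm{eval}]\circ\langle g,a,h,0\rangle=\mathrm{eval}\circ\langle h,a\rangle$. A parametrized fixpoint operator is a family $\mathbf{fix}^X_A:\mathbb{C}(A\times X,X)\to\mathbb{C}(A,X)$ with $f\circ\langle 1_A,\mathbf{fix}^X_A(f)\rangle=\mathbf{fix}^X_A(f)$ and $\mathbf{fix}^X_B(f)\circ g=\mathbf{fix}^X_A(f\circ(g\times 1_X))$. The differential-fixpoint rule: $\mathbf{D}[\mathbf{fix}^X_A(f)]=\pi_2\circ\mathbf{fix}^{X\times X}_{A\times A}(\mathbf{T}(f)\circ c)$ for all $f:A\times X\to X$, where $\mathbf{T}(f)=\langle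 f\circ\pi_1,\mathbf{D}[f]\rangle$ and $c=\langle\pi_1,\pi_3,\pi_2,\pi_4\rangle$ swaps the middle two factors. Standing assumptions: (a) Order and subtraction: each hom-set $\mathbb{C}(A,B)$ carries the natural order $g\le f\iff\exists h,\ g+h=f$, and for all $f,g\in\mathbb{C}(A,B)$ there is a map $f\ominus g\in\mathbb{C}(A,B)$ such that for all $h$: $h\ge f\ominus g\iff g+h\ge f$. (b) $\mathbb{C}$ is $\omega$-cpo enriched for this order (hom-sets are $\omega$-cpos, composition is Scott-continuous), $0$ is the bottom element, and addition commutes with suprema of $\omega$-chains. (c) $\mathbb{C}$ is a Taylor category: every map equals its Taylor expansion, $f(a+b)=\sum_n\frac{1}{n!}\frac{\mathsf{d}^nf(x)}{\mathsf{d}x^n}(a)\cdot(b,\dots,b)$, equivalently for $b\le a$, $f(a)=\sum_n\frac{1}{n!}\frac{\mathsf{d}^nf(x)}{\mathsf{d}x^n}(b)\cdot(a\ominus b,\dots,a\ominus b)$ (multiplication by $\frac1{n!}$ is assumed to make sense on hom-sets, and infinite sums are suprema of their finite partial sums). (d) The fixpoint combinator $\mathcal{Y}:(A\Rightarrow A)\to A$, $\mathcal{Y}=\mathbf{fix}(\mathrm{eval}_{A,A})$, is the supremum $\mathcal{Y}=\bigvee_n\mathcal{Y}_n$ with $\mathcal{Y}_0=0$, $\mathcal{Y}_{n+1}=\mathrm{eval}\circ\langle 1_{A\Rightarrow A},\mathcal{Y}_n\rangle$; correspondingly $\mathbf{fix}^X_A(f)=\mathcal{Y}_X\circ\lambda(f)$,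 where $\lambda(f):A\to(X\Rightarrow X)$ is the currying of $f$. Repetition operator: for a linear endomorphism $j$ (i.e. $\mathbf{D}[j]=j\circ\pi_2$), $j^*(b)=\mu y.(b+j(y))$, i.e. $j^*=\mathbf{fix}(\pi_1+j\circ\pi_2)$. With parameters: for $f:A\times X\to X$ and $z,b:A\to X$, $\left(\frac{\mathsf{d}f(a,v)}{\mathsf{d}v}(z(a))\right)^*\cdot b(a):=\mu y.\left(b(a)+\frac{\mathsf{d}f(a,v)}{\mathsf{d}v}(z(a))\cdot y\right)$, the map obtained by applying $\mathbf{fix}^X_A$. Newton approximants. The Newton operator sends $f:A\times X\to X$ to $\mathcal{N}(f):(a,x)\mapsto x+\left(\frac{\mathsf{d}f(a,v)}{\mathsf{d}v}(x)\right)^*\cdot(f(a,x)\ominus x)$; the approximants $\mathcal{Z}_n(f)=z_n:A\to X$ are $z_0=0$ and $z_{n+1}=\mathcal{N}(f)(-,z_n)$, that is, $z_{n+1}(a)=z_n(a)+\left(\frac{\mathsf{d}f(a,v)}{\mathsf{d}v}(z_n(a))\right)^*\cdot(f(a,z_n(a))\ominus z_n(a))$, where $f(a,z_n(a))\ominus z_n(a)$ is the truncated subtraction $(f\circ\langle 1_A,z_n\rangle)\ominus z_n$ in $\mathbb{C}(A,X)$. The maps $\mathcal{Z}_n:(A\Rightarrow A)\to A$ are those obtained for the evaluation map $\mathrm{eval}_{A,A}:(A\Rightarrow A)\times A\to A$; in the paper's notation $\mathcal{Z}_0=0$, $\mathcal{Z}_{n+1}=\mathrm{eval}\circ\langle\mathcal{N},\mathcal{Z}_n\rangle$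 with $\mathcal{N}:(A\Rightarrow A)\to(A\Rightarrow A)$, $f\mapsto\lambda a.(a+(\mathbf{D}_a[f])^*\cdot(f(a)\ominus a))$, $\mathbf{D}_a[f]\cdot b=\frac{\mathsf{d}f(x)}{\mathsf{d}x}(a)\cdot b$. Taylor distance. For $f\in\mathbb{C}(A,B)$, the $n$-th Taylor monomial is $\mathcal{M}_n(f)(a):=\frac{\mathsf{d}^nf(x)}{\mathsf{d}x^n}(0)\cdot(a,\dots,a)$. For $f,g\in\mathbb{C}(A,B)$, $d(f,g)=2^{-k}$ with $k=\inf\{n\in\mathbb{N}\mid\mathcal{M}_n(f)\ne\mathcal{M}_n(g)\}$ if this set is nonempty, and $d(f,g)=0$ otherwise. *)

theory Defs
  imports Complex_Main
begin

text \<open>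
  The objects are the elements of the type 'o. Finite products are given by a terminal object and
  binary products, so a tuple of four components is the pair of pairs
  \<open>\<langle>\<langle>w, x\<rangle>, \<langle>y, z\<rangle>\<rangle>\<close>. All operations are only constrained on the appropriate hom-sets.
\<close>

record ('o, 'm) dcat =
  Hom   :: "'o \<Rightarrow> 'o \<Rightarrow> 'm set"
  Id    :: "'o \<Rightarrow> 'm"
  Comp  :: "'m \<Rightarrow> 'm \<Rightarrow> 'm"  (infixr "\<cdot>\<index>" 75)
  Zero  :: "'o \<Rightarrow> 'o \<Rightarrow> 'm"
  Plus  :: "'m \<Rightarrow> 'm \<Rightarrow> 'm"  (infixl "\<oplus>\<index>" 65)
  One   :: "'o"
  Prod  :: "'o \<Rightarrow> 'o \<Rightarrow> 'o"  (infixr "\<boxtimes>\<index>" 80)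
  Proj1 :: "'o \<Rightarrow> 'o \<Rightarrow> 'm"
  Proj2 :: "'o \<Rightarrow> 'o \<Rightarrow> 'm"
  Pair  :: "'m \<Rightarrow> 'm \<Rightarrow> 'm"  ("\<langle>_,/ _\<rangle>\<index>")
  Diff  :: "'m \<Rightarrow> 'm"
  Exp   :: "'o \<Rightarrow> 'o \<Rightarrow> 'o"  (infixr "\<rightarrowtail>\<index>" 80)
  Eval  :: "'o \<Rightarrow> 'o \<Rightarrow> 'm"
  Curry :: "'o \<Rightarrow> 'o \<Rightarrow> 'm \<Rightarrow> 'm"
  Fix   :: "'o \<Rightarrow> 'o \<Rightarrow> 'm \<Rightarrow> 'm"

locale left_additive_category =
  fixes C :: "('o, 'm) dcat" (structure)
  assumes Hom_disjoint: "\<lbrakk>f \<in> Hom C A B; f \<in> Hom C A' B'\<rbrakk> \<Longrightarrow> A = A' \<and> B = B'"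
    and Id_in_Hom: "Id C A \<in> Hom C A A"
    and Comp_in_Hom: "\<lbrakk>g \<in> Hom C B E; f \<in> Hom C A B\<rbrakk> \<Longrightarrow> g \<cdot> f \<in> Hom C A E"
    and Id_left: "f \<in> Hom C A B \<Longrightarrow> Id C B \<cdot> f = f"
    and Id_right: "f \<in> Hom C A B \<Longrightarrow> f \<cdot> Id C A = f"
    and Comp_assoc: "\<lbrakk>h \<in> Hom C E F; g \<in> Hom C B E; f \<in> Hom C A B\<rbrakk>
          \<Longrightarrow> (h \<cdot> g) \<cdot> f = h \<cdot> (g \<cdot> f)"
    and Zero_in_Hom: "Zero C A B \<in> Hom C A B"
    and Plus_in_Hom: "\<lbrakk>f \<in> Hom C A B; g \<in> Hom C A B\<rbrakk> \<Longrightarrow> f \<oplus> g \<in> Hom C A B"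
    and Plus_assoc: "\<lbrakk>f \<in> Hom C A B; g \<in> Hom C A B; h \<in> Hom C A B\<rbrakk>
          \<Longrightarrow> (f \<oplus> g) \<oplus> h = f \<oplus> (g \<oplus> h)"
    and Plus_comm: "\<lbrakk>f \<in> Hom C A B; g \<in> Hom C A B\<rbrakk> \<Longrightarrow> f \<oplus> g = g \<oplus> f"
    and Plus_Zero: "f \<in> Hom C A B \<Longrightarrow> f \<oplus> Zero C A B = f"
    and Plus_Comp: "\<lbrakk>f \<in> Hom C B E; g \<in> Hom C B E; x \<in> Hom C A B\<rbrakk>
          \<Longrightarrow> (f \<oplus> g) \<cdot> x = f \<cdot> x \<oplus> g \<cdot> x"
    and Zero_Comp: "x \<in> Hom C A B \<Longrightarrow> Zero C B E \<cdot> x = Zero C A E"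

definition additive :: "('o, 'm) dcat \<Rightarrow> 'o \<Rightarrow> 'o \<Rightarrow> 'm \<Rightarrow> bool" where
  "additive C A B f \<longleftrightarrow> f \<in> Hom C A B \<and>
     (\<forall>Z. \<forall>x \<in> Hom C Z A. \<forall>y \<in> Hom C Z A. f \<cdot> (x \<oplus> y) = f \<cdot> x \<oplus> f \<cdot> y) \<and>
     (\<forall>Z. f \<cdot> Zero C Z A = Zero C Z B)" for C (structure)

locale cartesian_left_additive_category = left_additive_category +
  assumes One_terminal: "\<exists>!t. t \<in> Hom C A (One C)"
    and Proj1_in_Hom: "Proj1 C A B \<in> Hom C (A \<boxtimes> B) A"
    and Proj2_in_Hom: "Proj2 C A B \<in> Hom C (A \<boxtimes> B) B"
    and Pair_in_Hom: "\<lbrakk>f \<in> Hom C Z A; g \<in> Hom C Z B\<rbrakk> \<Longrightarrow> \<langle>f, g\<rangle> \<in> Hom C Z (A \<boxtimes> B)"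
    and Proj1_Pair: "\<lbrakk>f \<in> Hom C Z A; g \<in> Hom C Z B\<rbrakk> \<Longrightarrow> Proj1 C A B \<cdot> \<langle>f, g\<rangle> = f"
    and Proj2_Pair: "\<lbrakk>f \<in> Hom C Z A; g \<in> Hom C Z B\<rbrakk> \<Longrightarrow> Proj2 C A B \<cdot> \<langle>f, g\<rangle> = g"
    and Pair_unique: "h \<in> Hom C Z (A \<boxtimes> B) \<Longrightarrow> \<langle>Proj1 C A B \<cdot> h, Proj2 C A B \<cdot> h\<rangle> = h"
    and Proj1_additive: "additive C (A \<boxtimes> B) A (Proj1 C A B)"
    and Proj2_additive: "additive C (A \<boxtimes> B) B (Proj2 C A B)"

locale cartesian_differential_category = cartesian_left_additive_category +
  assumes Diff_in_Hom: "f \<in> Hom C A B \<Longrightarrow> Diff C f \<in> Hom C (A \<boxtimes> A) B"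
    and CD1_Zero: "Diff C (Zero C A B) = Zero C (A \<boxtimes> A) B"
    and CD1_Plus: "\<lbrakk>f \<in> Hom C A B; g \<in> Hom C A B\<rbrakk> \<Longrightarrow> Diff C (f \<oplus> g) = Diff C f \<oplus> Diff C g"
    and CD2_Zero: "\<lbrakk>f \<in> Hom C A B; x \<in> Hom C Z A\<rbrakk>
          \<Longrightarrow> Diff C f \<cdot> \<langle>x, Zero C Z A\<rangle> = Zero C Z B"
    and CD2_Plus: "\<lbrakk>f \<in> Hom C A B; x \<in> Hom C Z A; y \<in> Hom C Z A; z \<in> Hom C Z A\<rbrakk>
          \<Longrightarrow> Diff C f \<cdot> \<langle>x, y \<oplus> z\<rangle> = Diff C f \<cdot> \<langle>x, y\<rangle> \<oplus> Diff C f \<cdot> \<langle>x, z\<rangle>"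
    and CD3_Id: "Diff C (Id C A) = Proj2 C A A"
    and CD3_Proj1: "Diff C (Proj1 C A B) = Proj1 C A B \<cdot> Proj2 C (A \<boxtimes> B) (A \<boxtimes> B)"
    and CD3_Proj2: "Diff C (Proj2 C A B) = Proj2 C A B \<cdot> Proj2 C (A \<boxtimes> B) (A \<boxtimes> B)"
    and CD4: "\<lbrakk>f \<in> Hom C Z A; g \<in> Hom C Z B\<rbrakk> \<Longrightarrow> Diff C \<langle>f, g\<rangle> = \<langle>Diff C f, Diff C g\<rangle>"
    and CD5: "\<lbrakk>f \<in> Hom C A B; g \<in> Hom C B E\<rbrakk>
          \<Longrightarrow> Diff C (g \<cdot> f) = Diff C g \<cdot> \<langle>f \<cdot> Proj1 C A A, Diff C f\<rangle>"
    and CD6: "\<lbrakk>f \<in> Hom C A B; x \<in> Hom C Z A; y \<in> Hom C Z A; z \<in> Hom C Z A\<rbrakk>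
          \<Longrightarrow> Diff C (Diff C f) \<cdot> \<langle>\<langle>x, y\<rangle>, \<langle>Zero C Z A, z\<rangle>\<rangle> = Diff C f \<cdot> \<langle>x, z\<rangle>"
    and CD7: "\<lbrakk>f \<in> Hom C A B; x \<in> Hom C Z A; y \<in> Hom C Z A; z \<in> Hom C Z A\<rbrakk>
          \<Longrightarrow> Diff C (Diff C f) \<cdot> \<langle>\<langle>x, y\<rangle>, \<langle>z, Zero C Z A\<rangle>\<rangle>
            = Diff C (Diff C f) \<cdot> \<langle>\<langle>x, z\<rangle>, \<langle>y, Zero C Z A\<rangle>\<rangle>"

definition prod_Id :: "('o, 'm) dcat \<Rightarrow> 'o \<Rightarrow> 'o \<Rightarrow> 'm \<Rightarrow> 'm" where
  \<comment> \<open>\<open>g \<times> 1\<^sub>X\<close> for \<open>g\<close> with domain \<open>A\<close>\<close>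
  "prod_Id C A X g = \<langle>g \<cdot> Proj1 C A X, Proj2 C A X\<rangle>" for C (structure)

locale cartesian_closed_differential_category = cartesian_differential_category +
  assumes Eval_in_Hom: "Eval C A B \<in> Hom C ((A \<rightarrowtail> B) \<boxtimes> A) B"
    and Curry_in_Hom: "f \<in> Hom C (Z \<boxtimes> A) B \<Longrightarrow> Curry C Z A f \<in> Hom C Z (A \<rightarrowtail> B)"
    and Eval_Curry: "f \<in> Hom C (Z \<boxtimes> A) B \<Longrightarrow> Eval C A B \<cdot> prod_Id C Z A (Curry C Z A f) = f"
    and Curry_Eval: "g \<in> Hom C Z (A \<rightarrowtail> B) \<Longrightarrow> Curry C Z A (Eval C A B \<cdot> prod_Id C Z A g) = g"
    and Diff_Eval: "\<lbrakk>g \<in> Hom C Z (A \<rightarrowtail> B); a \<in> Hom C Z A; h \<in> Hom C Z (A \<rightarrowtail> B)\<rbrakk>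
          \<Longrightarrow> Diff C (Eval C A B) \<cdot> \<langle>\<langle>g, a\<rangle>, \<langle>h, Zero C Z A\<rangle>\<rangle> = Eval C A B \<cdot> \<langle>h, a\<rangle>"

definition tangent :: "('o, 'm) dcat \<Rightarrow> 'o \<Rightarrow> 'm \<Rightarrow> 'm" where
  "tangent C A f = \<langle>f \<cdot> Proj1 C A A, Diff C f\<rangle>" for C (structure)

definition swap_mid :: "('o, 'm) dcat \<Rightarrow> 'o \<Rightarrow> 'o \<Rightarrow> 'm" where
  \<comment> \<open>the isomorphism \<open>(A \<times> A) \<times> (X \<times> X) \<rightarrow> (A \<times> X) \<times> (A \<times> X)\<close>\<close>
  "swap_mid C A X =
     (let p = Proj1 C (A \<boxtimes> A) (X \<boxtimes> X); q = Proj2 C (A \<boxtimes> A) (X \<boxtimes> X)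
      in \<langle>\<langle>Proj1 C A A \<cdot> p, Proj1 C X X \<cdot> q\<rangle>, \<langle>Proj2 C A A \<cdot> p, Proj2 C X X \<cdot> q\<rangle>\<rangle>)"
  for C (structure)

locale differential_fixpoint_category = cartesian_closed_differential_category +
  assumes Fix_in_Hom: "f \<in> Hom C (A \<boxtimes> X) X \<Longrightarrow> Fix C A X f \<in> Hom C A X"
    and Fix_fixpoint: "f \<in> Hom C (A \<boxtimes> X) X \<Longrightarrow> f \<cdot> \<langle>Id C A, Fix C A X f\<rangle> = Fix C A X f"
    and Fix_natural: "\<lbrakk>f \<in> Hom C (B \<boxtimes> X) X; g \<in> Hom C A B\<rbrakk>
          \<Longrightarrow> Fix C B X f \<cdot> g = Fix C A X (f \<cdot> prod_Id C A X g)"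
    and differential_fixpoint_rule: "f \<in> Hom C (A \<boxtimes> X) X
          \<Longrightarrow> Diff C (Fix C A X f)
            = Proj2 C X X \<cdot> Fix C (A \<boxtimes> A) (X \<boxtimes> X) (tangent C (A \<boxtimes> X) f \<cdot> swap_mid C A X)"

definition nat_le :: "('o, 'm) dcat \<Rightarrow> 'm \<Rightarrow> 'm \<Rightarrow> bool"  (infix "\<sqsubseteq>\<index>" 50) where
  "f \<sqsubseteq> g \<longleftrightarrow> (\<exists>A B. f \<in> Hom C A B \<and> (\<exists>h \<in> Hom C A B. f \<oplus> h = g))" for C (structure)

definition is_monus :: "('o, 'm) dcat \<Rightarrow> 'o \<Rightarrow> 'o \<Rightarrow> 'm \<Rightarrow> 'm \<Rightarrow> 'm \<Rightarrow> bool" where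
  "is_monus C A B f g d \<longleftrightarrow>
     d \<in> Hom C A B \<and> (\<forall>h \<in> Hom C A B. d \<sqsubseteq> h \<longleftrightarrow> f \<sqsubseteq> g \<oplus> h)" for C (structure)

definition monus :: "('o, 'm) dcat \<Rightarrow> 'o \<Rightarrow> 'o \<Rightarrow> 'm \<Rightarrow> 'm \<Rightarrow> 'm" where
  "monus C A B f g = (THE d. is_monus C A B f g d)"

definition is_omega_chain :: "('o, 'm) dcat \<Rightarrow> 'o \<Rightarrow> 'o \<Rightarrow> (nat \<Rightarrow> 'm) \<Rightarrow> bool" where
  "is_omega_chain C A B s \<longleftrightarrow> (\<forall>n. s n \<in> Hom C A B \<and> s n \<sqsubseteq> s (Suc n))" for C (structure)

definition is_omega_sup :: "('o, 'm) dcat \<Rightarrow> 'o \<Rightarrow> 'o \<Rightarrow> (nat \<Rightarrow> 'm) \<Rightarrow> 'm \<Rightarrow> bool" where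
  "is_omega_sup C A B s u \<longleftrightarrow>
     is_omega_chain C A B s \<and> u \<in> Hom C A B \<and> (\<forall>n. s n \<sqsubseteq> u) \<and>
     (\<forall>v \<in> Hom C A B. (\<forall>n. s n \<sqsubseteq> v) \<longrightarrow> u \<sqsubseteq> v)" for C (structure)

definition omega_sup :: "('o, 'm) dcat \<Rightarrow> 'o \<Rightarrow> 'o \<Rightarrow> (nat \<Rightarrow> 'm) \<Rightarrow> 'm" where
  "omega_sup C A B s = (THE u. is_omega_sup C A B s u)"

text \<open>
  Since \<^const>\<open>is_omega_sup\<close> includes the chain condition, continuity below subsumes monotonicity.
  Joint continuity on \<open>\<omega>\<close>-chains is the same as monotonicity plus continuity in each argument.
\<close>

locale omega_cpo_enriched_category = differential_fixpoint_category +
  assumes nat_le_antisym: "\<lbrakk>f \<sqsubseteq> g; g \<sqsubseteq> f\<rbrakk> \<Longrightarrow> f = g"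
    and monus_exists: "\<lbrakk>f \<in> Hom C A B; g \<in> Hom C A B\<rbrakk> \<Longrightarrow> \<exists>d. is_monus C A B f g d"
    and omega_sup_exists: "is_omega_chain C A B s \<Longrightarrow> \<exists>u. is_omega_sup C A B s u"
    and Zero_bottom: "f \<in> Hom C A B \<Longrightarrow> Zero C A B \<sqsubseteq> f"
    and Comp_continuous: "\<lbrakk>is_omega_sup C B E t v; is_omega_sup C A B s u\<rbrakk>
          \<Longrightarrow> is_omega_sup C A E (\<lambda>n. t n \<cdot> s n) (v \<cdot> u)"
    and Plus_continuous: "\<lbrakk>is_omega_sup C A B s u; is_omega_sup C A B t v\<rbrakk>
          \<Longrightarrow> is_omega_sup C A B (\<lambda>n. s n \<oplus> t n) (u \<oplus> v)"

primrec power_obj :: "('o, 'm) dcat \<Rightarrow> 'o \<Rightarrow> nat \<Rightarrow> 'o" where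
  "power_obj C A 0 = One C"
| "power_obj C A (Suc n) = power_obj C A n \<boxtimes>\<^bsub>C\<^esub> A"

primrec diag :: "('o, 'm) dcat \<Rightarrow> 'o \<Rightarrow> 'm \<Rightarrow> nat \<Rightarrow> 'm" where
  \<comment> \<open>the tuple \<open>\<langle>b, \<dots>, b\<rangle>\<close> of length \<open>n\<close> for \<open>b\<close> with domain \<open>Z\<close>;
      the unique map into the terminal object is the zero map\<close>
  "diag C Z b 0 = Zero C Z (One C)"
| "diag C Z b (Suc n) = \<langle>diag C Z b n, b\<rangle>\<^bsub>C\<^esub>"

primrec nth_diff :: "('o, 'm) dcat \<Rightarrow> 'o \<Rightarrow> 'm \<Rightarrow> nat \<Rightarrow> 'm" where
  \<comment> \<open>\<open>f\<^sup>(\<^sup>n\<^sup>) : A \<times> A\<^sup>n \<rightarrow> B\<close>, with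
      \<open>f\<^sup>(\<^sup>n\<^sup>+\<^sup>1\<^sup>)(a, (b\<^sub>1, \<dots>, b\<^sub>n\<^sub>+\<^sub>1)) = D[f\<^sup>(\<^sup>n\<^sup>)]((a, (b\<^sub>1, \<dots>, b\<^sub>n)), (b\<^sub>n\<^sub>+\<^sub>1, 0))\<close>\<close>
  "nth_diff C A f 0 = f \<cdot>\<^bsub>C\<^esub> Proj1 C A (One C)"
| "nth_diff C A f (Suc n) =
     (let P = power_obj C A n;
          a = Proj1 C A (P \<boxtimes>\<^bsub>C\<^esub> A);
          r = Proj2 C A (P \<boxtimes>\<^bsub>C\<^esub> A)
      in Diff C (nth_diff C A f n) \<cdot>\<^bsub>C\<^esub>
           \<langle>\<langle>a, Proj1 C P A \<cdot>\<^bsub>C\<^esub> r\<rangle>\<^bsub>C\<^esub>,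
            \<langle>Proj2 C P A \<cdot>\<^bsub>C\<^esub> r, Zero C (A \<boxtimes>\<^bsub>C\<^esub> (P \<boxtimes>\<^bsub>C\<^esub> A)) P\<rangle>\<^bsub>C\<^esub>\<rangle>\<^bsub>C\<^esub>)"

definition nth_diff_diag :: "('o, 'm) dcat \<Rightarrow> 'o \<Rightarrow> 'o \<Rightarrow> 'm \<Rightarrow> nat \<Rightarrow> 'm \<Rightarrow> 'm \<Rightarrow> 'm" where
  \<comment> \<open>\<open>d\<^sup>nf(x)/dx\<^sup>n (a) \<cdot> (b, \<dots>, b)\<close> for generalized elements \<open>a, b : Z \<rightarrow> A\<close>\<close>
  "nth_diff_diag C Z A f n a b = nth_diff C A f n \<cdot> \<langle>a, diag C Z b n\<rangle>" for C (structure)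

primrec nat_mult :: "('o, 'm) dcat \<Rightarrow> 'o \<Rightarrow> 'o \<Rightarrow> nat \<Rightarrow> 'm \<Rightarrow> 'm" where
  "nat_mult C A B 0 f = Zero C A B"
| "nat_mult C A B (Suc k) f = nat_mult C A B k f \<oplus>\<^bsub>C\<^esub> f"

definition inv_fact_mult :: "('o, 'm) dcat \<Rightarrow> 'o \<Rightarrow> 'o \<Rightarrow> nat \<Rightarrow> 'm \<Rightarrow> 'm" where
  "inv_fact_mult C A B n f = (THE g. g \<in> Hom C A B \<and> nat_mult C A B (fact n) g = f)"

primrec partial_sum :: "('o, 'm) dcat \<Rightarrow> 'o \<Rightarrow> 'o \<Rightarrow> (nat \<Rightarrow> 'm) \<Rightarrow> nat \<Rightarrow> 'm" where
  "partial_sum C A B t 0 = Zero C A B"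
| "partial_sum C A B t (Suc n) = partial_sum C A B t n \<oplus>\<^bsub>C\<^esub> t n"

text \<open>
  Multiplication by \<open>1/n!\<close> makes sense when multiplication by \<open>n!\<close> is bijective on each hom-set;
  this holds for all \<open>n\<close> exactly when the hom-sets are semimodules over the nonnegative rationals,
  and such a semimodule structure is then unique.
\<close>

locale taylor_category = omega_cpo_enriched_category +
  assumes fact_divisible: "f \<in> Hom C A B \<Longrightarrow> \<exists>!g. g \<in> Hom C A B \<and> nat_mult C A B (fact n) g = f"
    and Taylor: "\<lbrakk>f \<in> Hom C A B; a \<in> Hom C Z A; b \<in> Hom C Z A\<rbrakk>
          \<Longrightarrow> is_omega_sup C Z B
                (partial_sum C Z B (\<lambda>n. inv_fact_mult C Z B n (nth_diff_diag C Z A f n a b)))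
                (f \<cdot> (a \<oplus> b))"

definition fix_comb :: "('o, 'm) dcat \<Rightarrow> 'o \<Rightarrow> 'm" where
  "fix_comb C A = Fix C (A \<rightarrowtail> A) A (Eval C A A)" for C (structure)

primrec fix_comb_approx :: "('o, 'm) dcat \<Rightarrow> 'o \<Rightarrow> nat \<Rightarrow> 'm" where
  "fix_comb_approx C A 0 = Zero C (A \<rightarrowtail>\<^bsub>C\<^esub> A) A"
| "fix_comb_approx C A (Suc n) =
     Eval C A A \<cdot>\<^bsub>C\<^esub> \<langle>Id C (A \<rightarrowtail>\<^bsub>C\<^esub> A), fix_comb_approx C A n\<rangle>\<^bsub>C\<^esub>"

locale newton_category = taylor_category +
  assumes fix_comb_sup:
    "is_omega_sup C (A \<rightarrowtail> A) A (fix_comb_approx C A) (fix_comb C A)"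

context differential_fixpoint_category
begin

text \<open>By naturality, every fixpoint is obtained from the fixpoint combinator.\<close>

lemma Fix_eq_fix_comb:
  assumes "f \<in> Hom C (A \<boxtimes> X) X"
  shows "Fix C A X f = fix_comb C X \<cdot> Curry C A X f"
  using Fix_natural[OF Eval_in_Hom Curry_in_Hom[OF assms]] Eval_Curry[OF assms]
  by (simp add: fix_comb_def)

end

definition partial2 :: "('o, 'm) dcat \<Rightarrow> 'o \<Rightarrow> 'o \<Rightarrow> 'm \<Rightarrow> 'm \<Rightarrow> 'm \<Rightarrow> 'm \<Rightarrow> 'm" where
  \<comment> \<open>\<open>df(a,v)/dv (z) \<cdot> y\<close> for \<open>f : A \<times> X \<rightarrow> B\<close> and generalized elements
      \<open>a : Z \<rightarrow> A\<close> and \<open>z, y : Z \<rightarrow> X\<close>\<close>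
  "partial2 C Z A f a z y = Diff C f \<cdot> \<langle>\<langle>a, z\<rangle>, \<langle>Zero C Z A, y\<rangle>\<rangle>" for C (structure)

definition repetition :: "('o, 'm) dcat \<Rightarrow> 'o \<Rightarrow> 'o \<Rightarrow> 'm \<Rightarrow> 'm \<Rightarrow> 'm \<Rightarrow> 'm" where
  \<comment> \<open>\<open>(df(a,v)/dv (z(a)))\<^sup>* \<cdot> b(a) = \<mu>y. (b(a) + df(a,v)/dv (z(a)) \<cdot> y)\<close>\<close>
  "repetition C A X f z b =
     Fix C A X
       (b \<cdot> Proj1 C A X \<oplus>
        partial2 C (A \<boxtimes> X) A f (Proj1 C A X) (z \<cdot> Proj1 C A X) (Proj2 C A X))" for C (structure)

primrec newton_approx :: "('o, 'm) dcat \<Rightarrow> 'o \<Rightarrow> 'o \<Rightarrow> 'm \<Rightarrow> nat \<Rightarrow> 'm" where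
  "newton_approx C A X f 0 = Zero C A X"
| "newton_approx C A X f (Suc n) =
     (let z = newton_approx C A X f n
      in z \<oplus>\<^bsub>C\<^esub> repetition C A X f z (monus C A X (f \<cdot>\<^bsub>C\<^esub> \<langle>Id C A, z\<rangle>\<^bsub>C\<^esub>) z))"

definition newton_comb :: "('o, 'm) dcat \<Rightarrow> 'o \<Rightarrow> nat \<Rightarrow> 'm" where
  "newton_comb C A = newton_approx C (A \<rightarrowtail> A) A (Eval C A A)" for C (structure)

definition nilpotent_partial2 :: "('o, 'm) dcat \<Rightarrow> 'o \<Rightarrow> 'o \<Rightarrow> 'm \<Rightarrow> bool" where
  "nilpotent_partial2 C A X f \<longleftrightarrow>
     (\<exists>p\<ge>1. \<forall>Z. \<forall>a \<in> Hom C Z A. \<forall>z \<in> Hom C Z X. \<forall>b \<in> Hom C Z X.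
        (partial2 C Z A f a z ^^ p) b = Zero C Z X)"

definition taylor_monomial :: "('o, 'm) dcat \<Rightarrow> 'o \<Rightarrow> nat \<Rightarrow> 'm \<Rightarrow> 'm" where
  "taylor_monomial C A n f = nth_diff_diag C A A f n (Zero C A A) (Id C A)"

definition taylor_dist :: "('o, 'm) dcat \<Rightarrow> 'o \<Rightarrow> 'm \<Rightarrow> 'm \<Rightarrow> real" where
  "taylor_dist C A f g =
     (if \<exists>n. taylor_monomial C A n f \<noteq> taylor_monomial C A n g
      then 1 / 2 ^ (LEAST n. taylor_monomial C A n f \<noteq> taylor_monomial C A n g)
      else 0)"

end

theory Submission
  imports Defs
begin

text \<open>
  Write \<open>f(z)\<close> for \<open>f \<cdot> \<langle>Id, z\<rangle>\<close>, \<open>D y\<close> for the second partial derivative of \<open>f\<close> at \<open>z\<close>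
  applied to \<open>y\<close>, and \<open>u\<close> for the fixpoint of \<open>f\<close>. Since the fixpoint combinator is a supremum of
  iterates, \<open>u\<close> is the supremum of the Kleene iterates \<open>0, f(0), f(f(0)), \<dots>\<close>.

  Convergence from below. Cutting the Taylor expansion after the linear term gives
  \<open>f(z) \<oplus> D y \<sqsubseteq> f(z \<oplus> y)\<close>. Assume \<open>z \<sqsubseteq> f(z)\<close> and \<open>z \<sqsubseteq> u\<close>, let \<open>\<delta> = f(z) \<ominus> z\<close>, so that
  \<open>z \<oplus> \<delta> = f(z)\<close>, and let \<open>s = \<mu>y. \<delta> \<oplus> D y\<close> be the Newton correction. Then
  \<open>z \<oplus> s = f(z) \<oplus> D s \<sqsubseteq> f(z \<oplus> s)\<close>; and \<open>z \<oplus> s \<sqsubseteq> u\<close>, because for the iterates \<open>y\<close> that define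
  \<open>s\<close> the bound \<open>z \<oplus> y \<sqsubseteq> u\<close> gives \<open>z \<oplus> \<delta> \<oplus> D y \<sqsubseteq> f(z \<oplus> y) \<sqsubseteq> f(u) = u\<close>. Also
  \<open>f(z) \<sqsubseteq> z \<oplus> s\<close>, so the Newton approximants dominate the Kleene iterates, and they have the same
  supremum (\<open>newton_step\<close>, \<open>newton_sup\<close>).

  Quadratic rate. Addition need not be cancellative, so the equations that usually determine the
  error cannot be subtracted from each other; every step below only rewrites a decomposition
  \<open>u = z \<oplus> h\<close> into another one. Suppose that the monomials of \<open>z\<close> and \<open>u\<close> agree below degree \<open>k\<close>.
  In \<open>u = z \<oplus> h\<close> the error \<open>h\<close> may be replaced by the part of its Taylor expansion of degree at least
  \<open>k\<close>, because below degree \<open>k\<close> the monomials of \<open>z\<close> alone already give those of \<open>u\<close>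
  (\<open>high_order_difference\<close>). Moreover \<open>\<delta> \<sqsubseteq> h\<close>, so \<open>\<delta>\<close> also has order \<open>k\<close>. Taylor expansion of \<open>f\<close> at
  \<open>z\<close> now gives \<open>u = f(z \<oplus> h) = z \<oplus> (\<delta> \<oplus> D h \<oplus> R)\<close>, where \<open>R\<close> has order \<open>2k\<close> since its terms are
  at least quadratic in \<open>h\<close>. So \<open>\<delta> \<oplus> D h \<oplus> R\<close> is again an error of order \<open>k\<close>. Repeating this \<open>p\<close> times
  turns the error into \<open>P \<oplus> D\<^sup>p h \<oplus> E\<close> with \<open>P = \<delta> \<oplus> D \<delta> \<oplus> \<dots> \<oplus> D\<^sup>p\<^sup>-\<^sup>1 \<delta>\<close> and \<open>E\<close> of order \<open>2k\<close>, and
  unfolding \<open>s = \<delta> \<oplus> D s\<close> as often gives \<open>s = P \<oplus> D\<^sup>p s\<close> with the same \<open>P\<close>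
  (\<open>newton_error_expansion\<close>). When \<open>D\<^sup>p = 0\<close> this says \<open>u = (z \<oplus> s) \<oplus> E\<close>, so the next approximant
  agrees with \<open>u\<close> below degree \<open>2k\<close> (\<open>newton_doubles_agreement\<close>).

  The order of a map at \<open>0\<close> is expressed through iterated derivatives (\<open>vanishes\<close>) rather than through
  the diagonal monomials, because that form is inherited by derivatives and admits proofs by
  induction. The central fact about it is that a multilinear map, applied to arguments of given
  orders, has at least the sum of these orders (\<open>vanishes_linear_snd\<close>, \<open>vanishes_nth_diff_diag\<close>).
  Orders pass to infinite sums because differentiation is continuous, which holds since evaluation is
  linear in the function (\<open>Diff_via_Eval\<close>).
\<close>

section \<open>Composability and the natural order\<close>

context left_additive_category
begin

text \<open>
  Hom-sets are disjoint, so a map determines its source and target. Composability of two maps is then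
  an equation between objects that rewriting can decide, instead of a membership condition in which
  the middle object has to be guessed.
\<close>

definition arr :: "'m \<Rightarrow> bool" where
  "arr f \<longleftrightarrow> (\<exists>A B. f \<in> Hom C A B)"

definition src :: "'m \<Rightarrow> 'o" where
  "src f = (THE A. \<exists>B. f \<in> Hom C A B)"

definition tgt :: "'m \<Rightarrow> 'o" where
  "tgt f = (THE B. \<exists>A. f \<in> Hom C A B)"

lemma src_tgt_Hom:
  assumes "f \<in> Hom C A B"
  shows "src f = A" "tgt f = B"
  unfolding src_def tgt_def using assms Hom_disjoint by blast+

lemma in_Hom_iff: "f \<in> Hom C A B \<longleftrightarrow> arr f \<and> src f = A \<and> tgt f = B"
  using src_tgt_Hom unfolding arr_def by metis

lemma Id_typing [simp]: "arr (Id C A)" "src (Id C A) = A" "tgt (Id C A) = A"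
  using Id_in_Hom[of A] by (simp_all add: in_Hom_iff)

lemma Comp_typing [simp]:
  assumes "arr g" "arr f" "src g = tgt f"
  shows "arr (g \<cdot> f)" "src (g \<cdot> f) = src f" "tgt (g \<cdot> f) = tgt g"
  using Comp_in_Hom[of g "src g" "tgt g" f "src f"] assms by (simp_all add: in_Hom_iff)

lemma Zero_typing [simp]: "arr (Zero C A B)" "src (Zero C A B) = A" "tgt (Zero C A B) = B"
  using Zero_in_Hom[of A B] by (simp_all add: in_Hom_iff)

lemma Plus_typing [simp]:
  assumes "arr f" "arr g" "src g = src f" "tgt g = tgt f"
  shows "arr (f \<oplus> g)" "src (f \<oplus> g) = src f" "tgt (f \<oplus> g) = tgt f"
  using Plus_in_Hom[of f "src f" "tgt f" g] assms by (simp_all add: in_Hom_iff)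

lemma Comp_Id [simp]:
  "arr f \<Longrightarrow> tgt f = B \<Longrightarrow> Id C B \<cdot> f = f"
  "arr f \<Longrightarrow> src f = A \<Longrightarrow> f \<cdot> Id C A = f"
  using Id_left Id_right by (auto simp: in_Hom_iff)

lemma Comp_assoc' [simp]:
  "\<lbrakk>arr h; arr g; arr f; src h = tgt g; src g = tgt f\<rbrakk> \<Longrightarrow> (h \<cdot> g) \<cdot> f = h \<cdot> (g \<cdot> f)"
  using Comp_assoc by (auto simp: in_Hom_iff)

lemma Plus_monoid:
  "\<lbrakk>arr f; arr g; arr h; src g = src f; tgt g = tgt f; src h = src f; tgt h = tgt f\<rbrakk>
    \<Longrightarrow> (f \<oplus> g) \<oplus> h = f \<oplus> (g \<oplus> h)"
  "\<lbrakk>arr f; arr g; src g = src f; tgt g = tgt f\<rbrakk> \<Longrightarrow> f \<oplus> g = g \<oplus> f"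
  using Plus_assoc Plus_comm by (auto simp: in_Hom_iff)

lemma Plus_left_comm:
  "\<lbrakk>arr f; arr g; arr h; src g = src f; tgt g = tgt f; src h = src f; tgt h = tgt f\<rbrakk>
    \<Longrightarrow> f \<oplus> (g \<oplus> h) = g \<oplus> (f \<oplus> h)"
  using Plus_monoid(1)[of f g h] Plus_monoid(1)[of g f h] Plus_monoid(2)[of f g] by simp

lemmas Plus_ac = Plus_monoid Plus_left_comm

lemma Plus_Zero' [simp]:
  "\<lbrakk>arr f; src f = A; tgt f = B\<rbrakk> \<Longrightarrow> f \<oplus> Zero C A B = f"
  "\<lbrakk>arr f; src f = A; tgt f = B\<rbrakk> \<Longrightarrow> Zero C A B \<oplus> f = f"
proof -
  assume f: "arr f" "src f = A" "tgt f = B"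
  then show eq: "f \<oplus> Zero C A B = f"
    using Plus_Zero[of f A B] by (simp add: in_Hom_iff)
  show "Zero C A B \<oplus> f = f"
    using f eq Plus_comm[of f A B "Zero C A B"] by (simp add: in_Hom_iff)
qed

lemma Plus_Comp' [simp]:
  "\<lbrakk>arr f; arr g; arr x; src g = src f; tgt g = tgt f; src f = tgt x\<rbrakk>
    \<Longrightarrow> (f \<oplus> g) \<cdot> x = f \<cdot> x \<oplus> g \<cdot> x"
  using Plus_Comp by (auto simp: in_Hom_iff)

lemma Zero_Comp' [simp]:
  "arr x \<Longrightarrow> tgt x = B \<Longrightarrow> Zero C B E \<cdot> x = Zero C (src x) E"
  using Zero_Comp by (auto simp: in_Hom_iff)

lemma le_iff:
  "f \<sqsubseteq> g \<longleftrightarrow> (\<exists>h. arr f \<and> arr h \<and> src h = src f \<and> tgt h = tgt f \<and> f \<oplus> h = g)"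
  unfolding nat_le_def by (auto simp: in_Hom_iff)

lemma leE:
  assumes "f \<sqsubseteq> g"
  obtains h where "arr f" "arr g" "src g = src f" "tgt g = tgt f"
    "arr h" "src h = src f" "tgt h = tgt f" "g = f \<oplus> h"
  using assms unfolding le_iff by auto

lemma le_typing:
  assumes "f \<sqsubseteq> g"
  shows "arr f" "arr g" "src g = src f" "tgt g = tgt f"
  using assms by (auto elim: leE)

lemma le_add: "\<lbrakk>arr f; arr h; src h = src f; tgt h = tgt f\<rbrakk> \<Longrightarrow> f \<sqsubseteq> f \<oplus> h"
  unfolding le_iff by auto

lemma le_refl: "arr f \<Longrightarrow> f \<sqsubseteq> f"
  using le_add[of f "Zero C (src f) (tgt f)"] by simp

lemma le_trans:
  assumes "f \<sqsubseteq> g" "g \<sqsubseteq> h"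
  shows "f \<sqsubseteq> h"
proof -
  obtain u where u: "arr f" "arr u" "src u = src f" "tgt u = tgt f" "g = f \<oplus> u"
    using assms(1) by (auto elim: leE)
  obtain v where v: "arr v" "src v = src g" "tgt v = tgt g" "h = g \<oplus> v"
    using assms(2) by (auto elim: leE)
  have "h = f \<oplus> (u \<oplus> v)" using u v by (simp add: Plus_ac)
  then show ?thesis using u v le_add[of f "u \<oplus> v"] by simp
qed

lemma Plus_mono:
  assumes "f \<sqsubseteq> f'" "g \<sqsubseteq> g'" "src f = src g" "tgt f = tgt g"
  shows "f \<oplus> g \<sqsubseteq> f' \<oplus> g'"
proof -
  obtain u where u: "arr f" "arr u" "src u = src f" "tgt u = tgt f" "f' = f \<oplus> u"
    using assms(1) by (auto elim: leE)
  obtain v where v: "arr g" "arr v" "src v = src g" "tgt v = tgt g" "g' = g \<oplus> v"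
    using assms(2) by (auto elim: leE)
  have "f' \<oplus> g' = (f \<oplus> g) \<oplus> (u \<oplus> v)" using u v assms by (simp add: Plus_ac)
  then show ?thesis using u v assms le_add[of "f \<oplus> g" "u \<oplus> v"] by simp
qed

end

section \<open>Pairing\<close>

context cartesian_left_additive_category
begin

lemma Proj_typing [simp]:
  "arr (Proj1 C A B)" "src (Proj1 C A B) = A \<boxtimes> B" "tgt (Proj1 C A B) = A"
  "arr (Proj2 C A B)" "src (Proj2 C A B) = A \<boxtimes> B" "tgt (Proj2 C A B) = B"
  using Proj1_in_Hom[of A B] Proj2_in_Hom[of A B] by (simp_all add: in_Hom_iff)

lemma Pair_typing [simp]:
  assumes "arr f" "arr g" "src g = src f"
  shows "arr \<langle>f, g\<rangle>" "src \<langle>f, g\<rangle> = src f" "tgt \<langle>f, g\<rangle> = tgt f \<boxtimes> tgt g"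
  using Pair_in_Hom[of f "src f" "tgt f" g "tgt g"] assms by (simp_all add: in_Hom_iff)

lemma Proj_Pair [simp]:
  "\<lbrakk>arr f; arr g; src g = src f; tgt f = A; tgt g = B\<rbrakk> \<Longrightarrow> Proj1 C A B \<cdot> \<langle>f, g\<rangle> = f"
  "\<lbrakk>arr f; arr g; src g = src f; tgt f = A; tgt g = B\<rbrakk> \<Longrightarrow> Proj2 C A B \<cdot> \<langle>f, g\<rangle> = g"
  using Proj1_Pair Proj2_Pair by (auto simp: in_Hom_iff)

lemma Pair_Proj [simp]:
  "\<lbrakk>arr h; tgt h = A \<boxtimes> B\<rbrakk> \<Longrightarrow> \<langle>Proj1 C A B \<cdot> h, Proj2 C A B \<cdot> h\<rangle> = h"
  using Pair_unique by (auto simp: in_Hom_iff)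

lemma Pair_Proj_Id [simp]: "\<langle>Proj1 C A B, Proj2 C A B\<rangle> = Id C (A \<boxtimes> B)"
  using Pair_Proj[of "Id C (A \<boxtimes> B)" A B] by simp

lemma prod_ext:
  assumes "arr g" "arr h" "tgt g = A \<boxtimes> B" "tgt h = A \<boxtimes> B"
    and "Proj1 C A B \<cdot> g = Proj1 C A B \<cdot> h" "Proj2 C A B \<cdot> g = Proj2 C A B \<cdot> h"
  shows "g = h"
proof -
  have "\<langle>Proj1 C A B \<cdot> g, Proj2 C A B \<cdot> g\<rangle> = h"
    unfolding assms(5,6) by (rule Pair_Proj[OF assms(2,4)])
  then show ?thesis
    unfolding Pair_Proj[OF assms(1,3)] .
qed

lemma Pair_Comp [simp]:
  assumes "arr f" "arr g" "arr x" "src g = src f" "src f = tgt x"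
  shows "\<langle>f, g\<rangle> \<cdot> x = \<langle>f \<cdot> x, g \<cdot> x\<rangle>"
proof -
  let ?p = "Proj1 C (tgt f) (tgt g)" and ?q = "Proj2 C (tgt f) (tgt g)"
  have "(?p \<cdot> \<langle>f, g\<rangle>) \<cdot> x = ?p \<cdot> (\<langle>f, g\<rangle> \<cdot> x)" "(?q \<cdot> \<langle>f, g\<rangle>) \<cdot> x = ?q \<cdot> (\<langle>f, g\<rangle> \<cdot> x)"
    using assms by (intro Comp_assoc'; simp)+
  moreover have "?p \<cdot> \<langle>f, g\<rangle> = f" "?q \<cdot> \<langle>f, g\<rangle> = g"
    using assms by simp_all
  ultimately have eqs: "?p \<cdot> (\<langle>f, g\<rangle> \<cdot> x) = f \<cdot> x" "?q \<cdot> (\<langle>f, g\<rangle> \<cdot> x) = g \<cdot> x"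
    by simp_all
  have "arr (\<langle>f, g\<rangle> \<cdot> x)" "tgt (\<langle>f, g\<rangle> \<cdot> x) = tgt f \<boxtimes> tgt g"
    using assms by simp_all
  from Pair_Proj[OF this] show ?thesis
    unfolding eqs by (rule sym)
qed

lemma Proj_Plus [simp]:
  assumes "arr f" "arr g" "src g = src f" "tgt f = A \<boxtimes> B" "tgt g = A \<boxtimes> B"
  shows "Proj1 C A B \<cdot> (f \<oplus> g) = Proj1 C A B \<cdot> f \<oplus> Proj1 C A B \<cdot> g"
    "Proj2 C A B \<cdot> (f \<oplus> g) = Proj2 C A B \<cdot> f \<oplus> Proj2 C A B \<cdot> g"
  using Proj1_additive[of A B] Proj2_additive[of A B] assms
  by (auto simp: additive_def in_Hom_iff)

lemma Proj_Zero [simp]: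
  "Proj1 C A B \<cdot> Zero C Z (A \<boxtimes> B) = Zero C Z A"
  "Proj2 C A B \<cdot> Zero C Z (A \<boxtimes> B) = Zero C Z B"
  using Proj1_additive[of A B] Proj2_additive[of A B] by (auto simp: additive_def)

lemma Pair_Zero [simp]: "\<langle>Zero C Z A, Zero C Z B\<rangle> = Zero C Z (A \<boxtimes> B)"
  by (rule prod_ext[of _ _ A B]) simp_all

lemma Pair_Plus:
  assumes "arr f" "arr g" "arr f'" "arr g'" "src g = src f" "src f' = src f" "src g' = src f"
    "tgt f' = tgt f" "tgt g' = tgt g"
  shows "\<langle>f \<oplus> f', g \<oplus> g'\<rangle> = \<langle>f, g\<rangle> \<oplus> \<langle>f', g'\<rangle>"
  by (rule prod_ext[of _ _ "tgt f" "tgt g"]) (use assms in simp_all)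

lemma Pair_axes:
  assumes "arr f" "arr g" "src g = src f" "Z = src f" "tgt f = A" "tgt g = B"
  shows "\<langle>f, Zero C Z B\<rangle> \<oplus> \<langle>Zero C Z A, g\<rangle> = \<langle>f, g\<rangle>"
  using Pair_Plus[of f "Zero C Z B" "Zero C Z A" g] assms by simp

end

section \<open>Differentiation of composites\<close>

context cartesian_differential_category
begin

lemma Diff_typing [simp]:
  assumes "arr f"
  shows "arr (Diff C f)" "src (Diff C f) = src f \<boxtimes> src f" "tgt (Diff C f) = tgt f"
  using Diff_in_Hom[of f "src f" "tgt f"] assms by (simp_all add: in_Hom_iff)

declare CD1_Zero [simp] CD3_Id [simp] CD3_Proj1 [simp] CD3_Proj2 [simp]

lemma Diff_Plus [simp]:
  "\<lbrakk>arr f; arr g; src g = src f; tgt g = tgt f\<rbrakk> \<Longrightarrow> Diff C (f \<oplus> g) = Diff C f \<oplus> Diff C g"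
  using CD1_Plus by (auto simp: in_Hom_iff)

lemma Diff_Pair [simp]:
  "\<lbrakk>arr f; arr g; src g = src f\<rbrakk> \<Longrightarrow> Diff C \<langle>f, g\<rangle> = \<langle>Diff C f, Diff C g\<rangle>"
  using CD4 by (auto simp: in_Hom_iff)

lemma Diff_Comp [simp]:
  "\<lbrakk>arr f; arr g; src g = tgt f\<rbrakk>
    \<Longrightarrow> Diff C (g \<cdot> f) = Diff C g \<cdot> \<langle>f \<cdot> Proj1 C (src f) (src f), Diff C f\<rangle>"
  using CD5 by (auto simp: in_Hom_iff)

lemma Diff_dir_Zero [simp]:
  "\<lbrakk>arr f; arr x; tgt x = src f; Z = src x; A = src f\<rbrakk>
    \<Longrightarrow> Diff C f \<cdot> \<langle>x, Zero C Z A\<rangle> = Zero C Z (tgt f)"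
  using CD2_Zero by (auto simp: in_Hom_iff)

lemma Diff_dir_Zero_Zero [simp]:
  "\<lbrakk>arr f; A = src f\<rbrakk> \<Longrightarrow> Diff C f \<cdot> Zero C Z (A \<boxtimes> A) = Zero C Z (tgt f)"
  using Diff_dir_Zero[of f "Zero C Z A" Z A] by (simp del: Diff_dir_Zero)

lemma Diff_dir_Plus:
  "\<lbrakk>arr f; arr x; arr y; arr z; tgt x = src f; tgt y = src f; tgt z = src f;
    src y = src x; src z = src x\<rbrakk>
    \<Longrightarrow> Diff C f \<cdot> \<langle>x, y \<oplus> z\<rangle> = Diff C f \<cdot> \<langle>x, y\<rangle> \<oplus> Diff C f \<cdot> \<langle>x, z\<rangle>"
  using CD2_Plus by (auto simp: in_Hom_iff)

lemma Diff_Diff_linear [simp]: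
  "\<lbrakk>arr f; arr x; arr y; arr z; tgt x = src f; tgt y = src f; tgt z = src f;
    src y = src x; src z = src x; Z = src x; A = src f\<rbrakk>
    \<Longrightarrow> Diff C (Diff C f) \<cdot> \<langle>\<langle>x, y\<rangle>, \<langle>Zero C Z A, z\<rangle>\<rangle> = Diff C f \<cdot> \<langle>x, z\<rangle>"
  using CD6 by (auto simp: in_Hom_iff)

lemma Diff_Diff_sym:
  "\<lbrakk>arr f; arr x; arr y; arr z; tgt x = src f; tgt y = src f; tgt z = src f;
    src y = src x; src z = src x; Z = src x; A = src f\<rbrakk>
    \<Longrightarrow> Diff C (Diff C f) \<cdot> \<langle>\<langle>x, y\<rangle>, \<langle>z, Zero C Z A\<rangle>\<rangle>
      = Diff C (Diff C f) \<cdot> \<langle>\<langle>x, z\<rangle>, \<langle>y, Zero C Z A\<rangle>\<rangle>"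
  using CD7 by (auto simp: in_Hom_iff)

section \<open>Order of vanishing\<close>

text \<open>
  The locus at which vanishing is tested consists of the generalized elements \<open>w\<close> with \<open>r \<cdot> w = 0\<close>.
  For \<open>r\<close> an identity it is the origin; for \<open>r\<close> composed with a projection the remaining component is
  an unrestricted parameter.
\<close>

definition kills where
  "kills r w \<longleftrightarrow> arr w \<and> tgt w = src r \<and> r \<cdot> w = Zero C (src w) (tgt r)"

text \<open>
  All derivatives of \<open>g\<close> of order less than \<open>n\<close> vanish over the locus of \<open>r\<close>, in arbitrary directions.
  The derivative is the total one, on the tangent bundle, and a tangent vector counts as lying over the
  locus as soon as its base point does; this explains the first projection in the recursive call.
\<close>

primrec vanishes where
  "vanishes 0 r g = True"
| "vanishes (Suc n) r g =
     ((\<forall>w. kills r w \<longrightarrow> g \<cdot> w = Zero C (src w) (tgt g)) \<and>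
      vanishes n (r \<cdot> Proj1 C (src g) (src g)) (Diff C g))"

lemma vanishes_at:
  "vanishes n r g \<Longrightarrow> 0 < n \<Longrightarrow> kills r w \<Longrightarrow> g \<cdot> w = Zero C (src w) (tgt g)"
  by (cases n) auto

lemma vanishes_Suc: "vanishes (Suc n) r g \<Longrightarrow> vanishes n r g"
proof (induction n arbitrary: r g)
  case (Suc n)
  have "vanishes n (r \<cdot> Proj1 C (src g) (src g)) (Diff C g)"
    using Suc.prems unfolding vanishes.simps(2)[of "Suc n"] by (blast intro: Suc.IH)
  then show ?case
    using Suc.prems unfolding vanishes.simps(2)[of "Suc n"] vanishes.simps(2)[of n r g] by blast
qed simp

lemma vanishes_mono:
  assumes "vanishes n r g" "m \<le> n"
  shows "vanishes m r g"
  using assms(2,1) by (induction n rule: dec_induct) (blast dest: vanishes_Suc)+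

lemma vanishes_Diff:
  "vanishes n r g \<Longrightarrow> vanishes (n - 1) (r \<cdot> Proj1 C (src g) (src g)) (Diff C g)"
  by (cases n) auto

text \<open>
  The chain rule expresses the derivative of \<open>g \<cdot> e\<close> as the derivative of \<open>g\<close> composed with the tangent
  map of \<open>e\<close>, and the tangent map acts on base points as \<open>e\<close>. So no bound on the derivatives of \<open>e\<close>
  is involved, only that \<open>e\<close> maps one locus into the other.
\<close>

lemma vanishes_Comp:
  assumes "vanishes n r g" "arr g" "arr e" "tgt e = src g" "arr r" "src r = src g"
    "arr r'" "src r' = src e"
    and "\<And>w. kills r' w \<Longrightarrow> kills r (e \<cdot> w)"
  shows "vanishes n r' (g \<cdot> e)"
  using assms
proof (induction n arbitrary: r g e r')
  case (Suc n)
  let ?e = "\<langle>e \<cdot> Proj1 C (src e) (src e), Diff C e\<rangle>"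
  have "vanishes n (r' \<cdot> Proj1 C (src e) (src e)) (Diff C g \<cdot> ?e)"
  proof (rule Suc.IH)
    show "vanishes n (r \<cdot> Proj1 C (src g) (src g)) (Diff C g)"
      using Suc.prems(1) by simp
    fix w assume "kills (r' \<cdot> Proj1 C (src e) (src e)) w"
    then have w: "arr w" "tgt w = src e \<boxtimes> src e" and "kills r' (Proj1 C (src e) (src e) \<cdot> w)"
      using Suc.prems by (auto simp: kills_def)
    then have "kills r (e \<cdot> (Proj1 C (src e) (src e) \<cdot> w))"
      using Suc.prems by blast
    then show "kills (r \<cdot> Proj1 C (src g) (src g)) (?e \<cdot> w)"
      using w Suc.prems by (auto simp: kills_def)
  qed (use Suc.prems in simp_all)
  moreover have "(g \<cdot> e) \<cdot> w = Zero C (src w) (tgt (g \<cdot> e))" if w: "kills r' w" for w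
  proof -
    have "kills r (e \<cdot> w)" by (rule Suc.prems(9)[OF w])
    moreover have "arr w" "tgt w = src e" using w Suc.prems by (auto simp: kills_def)
    ultimately show ?thesis using Suc.prems(1-8) by auto
  qed
  ultimately show ?case using Suc.prems by simp
qed simp

lemma vanishes_Zero:
  assumes "arr r" "src r = A"
  shows "vanishes n r (Zero C A B)"
  using assms by (induction n arbitrary: r A) (auto simp: kills_def)

lemma vanishes_Plus:
  assumes "vanishes n r f" "vanishes n r g" "arr f" "arr g" "src g = src f" "tgt g = tgt f"
    "arr r" "src r = src f"
  shows "vanishes n r (f \<oplus> g)"
  using assms
proof (induction n arbitrary: r f g)
  case (Suc n)
  have "vanishes n (r \<cdot> Proj1 C (src f) (src f)) (Diff C f \<oplus> Diff C g)"
    using Suc.prems by (intro Suc.IH) auto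
  then show ?case using Suc.prems by (auto simp: kills_def)
qed simp

text \<open>
  Linearity in the differential sense, which implies additivity in the second argument and is stable
  under differentiation in the first.
\<close>

definition linear_snd where
  "linear_snd Q X \<psi> \<longleftrightarrow> arr \<psi> \<and> src \<psi> = Q \<boxtimes> X \<and>
     (\<forall>q x y. arr q \<longrightarrow> arr x \<longrightarrow> arr y \<longrightarrow> src x = src q \<longrightarrow> src y = src q \<longrightarrow>
        tgt q = Q \<longrightarrow> tgt x = X \<longrightarrow> tgt y = X \<longrightarrow>
        Diff C \<psi> \<cdot> \<langle>\<langle>q, x\<rangle>, \<langle>Zero C (src q) Q, y\<rangle>\<rangle> = \<psi> \<cdot> \<langle>q, y\<rangle>)"

lemma linear_sndD:
  assumes "linear_snd Q X \<psi>" "arr q" "arr x" "arr y" "src x = src q" "src y = src q"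
    "tgt q = Q" "tgt x = X" "tgt y = X" "Z = src q"
  shows "Diff C \<psi> \<cdot> \<langle>\<langle>q, x\<rangle>, \<langle>Zero C Z Q, y\<rangle>\<rangle> = \<psi> \<cdot> \<langle>q, y\<rangle>"
  using assms unfolding linear_snd_def by blast

lemma linear_snd_reparam:
  assumes "linear_snd Q X \<psi>" "arr e" "src e = P" "tgt e = Q"
  shows "linear_snd P X (\<psi> \<cdot> \<langle>e \<cdot> Proj1 C P X, Proj2 C P X\<rangle>)"
  unfolding linear_snd_def
proof (intro conjI allI impI)
  fix q x y
  assume h: "arr q" "arr x" "arr y" "src x = src q" "src y = src q" "tgt q = P" "tgt x = X" "tgt y = X"
  have "Diff C \<psi> \<cdot> \<langle>\<langle>e \<cdot> q, x\<rangle>, \<langle>Zero C (src q) Q, y\<rangle>\<rangle> = \<psi> \<cdot> \<langle>e \<cdot> q, y\<rangle>"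
    using assms h by (intro linear_sndD[OF assms(1)]) auto
  moreover have "arr \<psi>" "src \<psi> = Q \<boxtimes> X" using assms(1) by (auto simp: linear_snd_def)
  ultimately show "Diff C (\<psi> \<cdot> \<langle>e \<cdot> Proj1 C P X, Proj2 C P X\<rangle>) \<cdot> \<langle>\<langle>q, x\<rangle>, \<langle>Zero C (src q) P, y\<rangle>\<rangle>
      = (\<psi> \<cdot> \<langle>e \<cdot> Proj1 C P X, Proj2 C P X\<rangle>) \<cdot> \<langle>q, y\<rangle>"
    using assms(2-) h by simp
qed (use assms in \<open>auto simp: linear_snd_def\<close>)

lemma linear_snd_Zero:
  assumes "linear_snd Q X \<psi>" "arr q" "tgt q = Q"
  shows "\<psi> \<cdot> \<langle>q, Zero C (src q) X\<rangle> = Zero C (src q) (tgt \<psi>)"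
proof -
  have "\<psi> \<cdot> \<langle>q, Zero C (src q) X\<rangle>
      = Diff C \<psi> \<cdot> \<langle>\<langle>q, Zero C (src q) X\<rangle>, \<langle>Zero C (src q) Q, Zero C (src q) X\<rangle>\<rangle>"
    using assms by (simp add: linear_snd_def del: Pair_Zero)
  also have "\<dots> = Zero C (src q) (tgt \<psi>)"
    using assms by (simp add: linear_snd_def)
  finally show ?thesis .
qed

text \<open>
  A derivative in the first argument is still linear in the second: mixed second derivatives commute,
  so one may differentiate in the second argument first, and there the map is its own derivative.
\<close>

lemma linear_snd_Diff_fst:
  assumes "linear_snd Q X \<psi>"
  defines "P \<equiv> Q \<boxtimes> Q"
  defines "p \<equiv> Proj1 C P X"
  shows "linear_snd P X (Diff C \<psi> \<cdot> \<langle>\<langle>Proj1 C Q Q \<cdot> p, Proj2 C P X\<rangle>,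
           \<langle>Proj2 C Q Q \<cdot> p, Zero C (P \<boxtimes> X) X\<rangle>\<rangle>)"
  unfolding linear_snd_def
proof (intro conjI allI impI)
  fix q x y
  assume h: "arr q" "arr x" "arr y" "src x = src q" "src y = src q" "tgt q = P" "tgt x = X" "tgt y = X"
  have \<psi>: "arr \<psi>" "src \<psi> = Q \<boxtimes> X" using assms by (auto simp: linear_snd_def)
  let ?q1 = "Proj1 C Q Q \<cdot> q" and ?q2 = "Proj2 C Q Q \<cdot> q"
  let ?Z = "src q"
  have eq: "Diff C \<psi> \<cdot> \<langle>Proj1 C (Q \<boxtimes> X) X, \<langle>Zero C ((Q \<boxtimes> X) \<boxtimes> X) Q, Proj2 C (Q \<boxtimes> X) X\<rangle>\<rangle>
      = \<psi> \<cdot> \<langle>Proj1 C Q X \<cdot> Proj1 C (Q \<boxtimes> X) X, Proj2 C (Q \<boxtimes> X) X\<rangle>" (is "?L = ?R")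
  proof -
    have "Diff C \<psi> \<cdot> \<langle>\<langle>Proj1 C Q X \<cdot> Proj1 C (Q \<boxtimes> X) X, Proj2 C Q X \<cdot> Proj1 C (Q \<boxtimes> X) X\<rangle>,
       \<langle>Zero C ((Q \<boxtimes> X) \<boxtimes> X) Q, Proj2 C (Q \<boxtimes> X) X\<rangle>\<rangle> = ?R"
      by (intro linear_sndD[OF assms(1)]) auto
    then show ?thesis by simp
  qed
  have "Diff C ?L \<cdot> \<langle>\<langle>\<langle>?q1, x\<rangle>, y\<rangle>, \<langle>\<langle>?q2, Zero C ?Z X\<rangle>, Zero C ?Z X\<rangle>\<rangle>
      = Diff C ?R \<cdot> \<langle>\<langle>\<langle>?q1, x\<rangle>, y\<rangle>, \<langle>\<langle>?q2, Zero C ?Z X\<rangle>, Zero C ?Z X\<rangle>\<rangle>"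
    by (simp only: eq)
  then have "Diff C (Diff C \<psi>) \<cdot> \<langle>\<langle>\<langle>?q1, x\<rangle>, \<langle>Zero C ?Z Q, y\<rangle>\<rangle>,
       \<langle>\<langle>?q2, Zero C ?Z X\<rangle>, Zero C ?Z (Q \<boxtimes> X)\<rangle>\<rangle>
     = Diff C \<psi> \<cdot> \<langle>\<langle>?q1, y\<rangle>, \<langle>?q2, Zero C ?Z X\<rangle>\<rangle>"
    using h \<psi> by (simp add: P_def)
  moreover have "Diff C (Diff C \<psi>) \<cdot> \<langle>\<langle>\<langle>?q1, x\<rangle>, \<langle>Zero C ?Z Q, y\<rangle>\<rangle>,
       \<langle>\<langle>?q2, Zero C ?Z X\<rangle>, Zero C ?Z (Q \<boxtimes> X)\<rangle>\<rangle>
     = Diff C (Diff C \<psi>) \<cdot> \<langle>\<langle>\<langle>?q1, x\<rangle>, \<langle>?q2, Zero C ?Z X\<rangle>\<rangle>,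
       \<langle>\<langle>Zero C ?Z Q, y\<rangle>, Zero C ?Z (Q \<boxtimes> X)\<rangle>\<rangle>"
    using h \<psi> by (intro Diff_Diff_sym) (auto simp: P_def)
  ultimately show "Diff C (Diff C \<psi> \<cdot> \<langle>\<langle>Proj1 C Q Q \<cdot> p, Proj2 C P X\<rangle>,
           \<langle>Proj2 C Q Q \<cdot> p, Zero C (P \<boxtimes> X) X\<rangle>\<rangle>) \<cdot> \<langle>\<langle>q, x\<rangle>, \<langle>Zero C (src q) P, y\<rangle>\<rangle>
     = (Diff C \<psi> \<cdot> \<langle>\<langle>Proj1 C Q Q \<cdot> p, Proj2 C P X\<rangle>,
           \<langle>Proj2 C Q Q \<cdot> p, Zero C (P \<boxtimes> X) X\<rangle>\<rangle>) \<cdot> \<langle>q, y\<rangle>"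
    using h \<psi> by (simp add: P_def p_def)
qed (use assms(1) in \<open>auto simp: linear_snd_def P_def p_def\<close>)

text \<open>
  Orders add up under application of a linear map: \<open>\<psi>\<close> contributes the order \<open>l\<close> that it has in its
  parameter, for every value of the linear argument, and \<open>h\<close> contributes \<open>k\<close>. By the product rule, the
  derivative of \<open>\<psi> \<cdot> \<langle>Id, h\<rangle>\<close> is a sum of two maps of the same shape. One differentiates \<open>\<psi>\<close> in its
  parameter and costs one order of \<open>\<psi>\<close>, the other differentiates \<open>h\<close> and costs one order of \<open>h\<close>.
\<close>

lemma vanishes_linear_snd:
  assumes "linear_snd Q X \<psi>" "vanishes l (r \<cdot> Proj1 C Q X) \<psi>"
    and "vanishes k r h" "arr h" "src h = Q" "tgt h = X" "arr r" "src r = Q" "n \<le> k + l"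
  shows "vanishes n r (\<psi> \<cdot> \<langle>Id C Q, h\<rangle>)"
  using assms
proof (induction n arbitrary: Q \<psi> l r k h)
  case (Suc n)
  have \<psi>: "arr \<psi>" "src \<psi> = Q \<boxtimes> X" using Suc.prems(1) by (auto simp: linear_snd_def)
  note h = Suc.prems(4-8) and lin = Suc.prems(1)
  let ?P = "Q \<boxtimes> Q"
  let ?p = "Proj1 C ?P X"
  let ?d = "\<langle>\<langle>Proj1 C Q Q \<cdot> ?p, Proj2 C ?P X\<rangle>, \<langle>Proj2 C Q Q \<cdot> ?p, Zero C (?P \<boxtimes> X) X\<rangle>\<rangle>"
  let ?\<psi>1 = "Diff C \<psi> \<cdot> ?d"
  let ?s = "\<langle>Proj1 C Q Q \<cdot> ?p, Proj2 C ?P X\<rangle>"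
  let ?\<psi>2 = "\<psi> \<cdot> ?s"
  let ?r = "r \<cdot> Proj1 C Q Q"
  have "Diff C (\<psi> \<cdot> \<langle>Id C Q, h\<rangle>)
      = Diff C \<psi> \<cdot> \<langle>\<langle>Proj1 C Q Q, h \<cdot> Proj1 C Q Q\<rangle>,
          \<langle>Proj2 C Q Q, Zero C ?P X\<rangle> \<oplus> \<langle>Zero C ?P Q, Diff C h\<rangle>\<rangle>"
    using h \<psi> by (simp add: Pair_axes)
  also have "\<dots> = ?\<psi>1 \<cdot> \<langle>Id C ?P, h \<cdot> Proj1 C Q Q\<rangle> \<oplus> ?\<psi>2 \<cdot> \<langle>Id C ?P, Diff C h\<rangle>"
  proof -
    have "Diff C \<psi> \<cdot> \<langle>\<langle>Proj1 C Q Q, h \<cdot> Proj1 C Q Q\<rangle>, \<langle>Zero C ?P Q, Diff C h\<rangle>\<rangle>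
        = \<psi> \<cdot> \<langle>Proj1 C Q Q, Diff C h\<rangle>"
      using h by (intro linear_sndD[OF lin]) auto
    then show ?thesis
      using h \<psi> by (subst Diff_dir_Plus) auto
  qed
  finally have eq: "Diff C (\<psi> \<cdot> \<langle>Id C Q, h\<rangle>)
      = ?\<psi>1 \<cdot> \<langle>Id C ?P, h \<cdot> Proj1 C Q Q\<rangle> \<oplus> ?\<psi>2 \<cdot> \<langle>Id C ?P, Diff C h\<rangle>" .
  have \<psi>1: "vanishes n ?r (?\<psi>1 \<cdot> \<langle>Id C ?P, h \<cdot> Proj1 C Q Q\<rangle>)"
  proof (rule Suc.IH)
    show "linear_snd ?P X ?\<psi>1"
      using linear_snd_Diff_fst[OF lin] .
    show "vanishes (l - 1) (?r \<cdot> ?p) ?\<psi>1"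
      by (rule vanishes_Comp[OF vanishes_Diff[OF Suc.prems(2)]]) (use h \<psi> in \<open>auto simp: kills_def\<close>)
    \<comment> \<open>for \<open>l = 0\<close> there is no order of \<open>\<psi>\<close> to lose, and one of \<open>h\<close> is given up instead\<close>
    show "vanishes (if l = 0 then k - 1 else k) ?r (h \<cdot> Proj1 C Q Q)"
      by (rule vanishes_Comp[OF vanishes_mono[OF Suc.prems(3)]])
        (use h in \<open>auto simp: kills_def\<close>)
    show "n \<le> (if l = 0 then k - 1 else k) + (l - 1)"
      using Suc.prems(9) by auto
  qed (use h in auto)
  have \<psi>2: "vanishes n ?r (?\<psi>2 \<cdot> \<langle>Id C ?P, Diff C h\<rangle>)"
  proof (rule Suc.IH)
    show "linear_snd ?P X ?\<psi>2"
      using linear_snd_reparam[OF lin, of "Proj1 C Q Q"] by simp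
    show "vanishes l (?r \<cdot> ?p) ?\<psi>2"
      by (rule vanishes_Comp[OF Suc.prems(2)]) (use h \<psi> in \<open>auto simp: kills_def\<close>)
    show "vanishes (k - 1) ?r (Diff C h)"
      using vanishes_Diff[OF Suc.prems(3)] h by simp
    show "n \<le> k - 1 + l" using Suc.prems(9) by simp
  qed (use h in auto)
  have "(\<psi> \<cdot> \<langle>Id C Q, h\<rangle>) \<cdot> w = Zero C (src w) (tgt \<psi>)" if "kills r w" for w
  proof -
    have w: "arr w" "tgt w = Q" using that h by (auto simp: kills_def)
    show ?thesis
    proof (cases "k = 0")
      case True
      then have "kills (r \<cdot> Proj1 C Q X) \<langle>w, h \<cdot> w\<rangle>" "0 < l"
        using that h w Suc.prems(9) by (auto simp: kills_def)
      then show ?thesis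
        using vanishes_at[OF Suc.prems(2)] h \<psi> w by simp
    next
      case False
      then have "h \<cdot> w = Zero C (src w) X"
        using vanishes_at[OF Suc.prems(3) _ that] h by simp
      then show ?thesis
        using linear_snd_Zero[OF lin w] h \<psi> w by simp
    qed
  qed
  then show ?case
    using vanishes_Plus[OF \<psi>1 \<psi>2] h \<psi> unfolding vanishes.simps eq by simp
qed simp

text \<open>
  The partial derivative of \<open>\<phi> : Q \<times> A \<rightarrow> B\<close> in its second argument.
\<close>

definition param_diff :: "'a \<Rightarrow> 'a \<Rightarrow> 'b \<Rightarrow> 'b" where
  "param_diff Q A \<phi> = Diff C \<phi> \<cdot>
     \<langle>Proj1 C (Q \<boxtimes> A) A, \<langle>Zero C ((Q \<boxtimes> A) \<boxtimes> A) Q, Proj2 C (Q \<boxtimes> A) A\<rangle>\<rangle>"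

lemma param_diff_typing [simp]:
  assumes "arr \<phi>" "src \<phi> = Q \<boxtimes> A"
  shows "arr (param_diff Q A \<phi>)" "src (param_diff Q A \<phi>) = (Q \<boxtimes> A) \<boxtimes> A"
    "tgt (param_diff Q A \<phi>) = tgt \<phi>"
  using assms by (simp_all add: param_diff_def)

text \<open>
  Where the locus constrains only the \<open>Q\<close>-component, \<open>A\<close> is a free parameter, and differentiating in a
  free parameter loses no order: at order zero, \<open>\<phi>\<close> is identically zero along \<open>A\<close>, so its
  derivative along \<open>A\<close> is too. For higher orders the second derivatives are exchanged, which turns the
  total derivative of the partial derivative into a partial derivative of the total derivative.
\<close>

lemma vanishes_param_diff:
  assumes "vanishes n (r \<cdot> Proj1 C Q A) \<phi>" "arr \<phi>" "src \<phi> = Q \<boxtimes> A" "arr r" "src r = Q"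
  shows "vanishes n (r \<cdot> (Proj1 C Q A \<cdot> Proj1 C (Q \<boxtimes> A) A)) (param_diff Q A \<phi>)"
  using assms
proof (induction n arbitrary: Q r \<phi>)
  case (Suc n)
  note \<phi> = Suc.prems(2-5)
  let ?W = "(Q \<boxtimes> A) \<boxtimes> A"
  let ?r = "r \<cdot> (Proj1 C Q A \<cdot> Proj1 C (Q \<boxtimes> A) A)"
  let ?Q = "Q \<boxtimes> (Q \<boxtimes> A)"
  let ?\<phi> = "Diff C \<phi> \<cdot> \<langle>\<langle>Proj1 C Q (Q \<boxtimes> A) \<cdot> Proj1 C ?Q A, Proj2 C ?Q A\<rangle>,
                       Proj2 C Q (Q \<boxtimes> A) \<cdot> Proj1 C ?Q A\<rangle>"
  let ?w = "Proj1 C (Q \<boxtimes> A) A \<cdot> Proj1 C ?W ?W" and ?y = "Proj2 C (Q \<boxtimes> A) A \<cdot> Proj1 C ?W ?W"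
  let ?w' = "Proj1 C (Q \<boxtimes> A) A \<cdot> Proj2 C ?W ?W" and ?y' = "Proj2 C (Q \<boxtimes> A) A \<cdot> Proj2 C ?W ?W"
  let ?e1 = "\<langle>\<langle>\<langle>Proj1 C Q A \<cdot> ?w, ?w'\<rangle>, Proj2 C Q A \<cdot> ?w\<rangle>, ?y\<rangle>"
  let ?e2 = "\<langle>?w, ?y'\<rangle>"
  let ?Z = "Zero C (?W \<boxtimes> ?W)"
  have "Diff C (param_diff Q A \<phi>)
      = Diff C (Diff C \<phi>) \<cdot> \<langle>\<langle>?w, \<langle>?Z Q, ?y\<rangle>\<rangle>, \<langle>?w', ?Z (Q \<boxtimes> A)\<rangle> \<oplus> \<langle>?Z (Q \<boxtimes> A), \<langle>?Z Q, ?y'\<rangle>\<rangle>\<rangle>"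
    using \<phi> by (simp add: param_diff_def Pair_axes)
  also have "\<dots> = Diff C (Diff C \<phi>) \<cdot> \<langle>\<langle>?w, ?w'\<rangle>, \<langle>\<langle>?Z Q, ?y\<rangle>, ?Z (Q \<boxtimes> A)\<rangle>\<rangle>
      \<oplus> Diff C \<phi> \<cdot> \<langle>?w, \<langle>?Z Q, ?y'\<rangle>\<rangle>"
  proof -
    have "Diff C (Diff C \<phi>) \<cdot> \<langle>\<langle>?w, \<langle>?Z Q, ?y\<rangle>\<rangle>, \<langle>?w', ?Z (Q \<boxtimes> A)\<rangle>\<rangle>
        = Diff C (Diff C \<phi>) \<cdot> \<langle>\<langle>?w, ?w'\<rangle>, \<langle>\<langle>?Z Q, ?y\<rangle>, ?Z (Q \<boxtimes> A)\<rangle>\<rangle>"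
      using \<phi> by (intro Diff_Diff_sym) auto
    then show ?thesis
      using \<phi> by (subst Diff_dir_Plus) auto
  qed
  also have "\<dots> = param_diff ?Q A ?\<phi> \<cdot> ?e1 \<oplus> param_diff Q A \<phi> \<cdot> ?e2"
    using \<phi> by (simp add: param_diff_def)
  finally have eq: "Diff C (param_diff Q A \<phi>)
      = param_diff ?Q A ?\<phi> \<cdot> ?e1 \<oplus> param_diff Q A \<phi> \<cdot> ?e2" .
  \<comment> \<open>the total derivative of \<open>\<phi>\<close>, with the direction of differentiation made part of the parameter\<close>
  have "vanishes n ((r \<cdot> Proj1 C Q (Q \<boxtimes> A)) \<cdot> Proj1 C ?Q A) ?\<phi>"
    by (rule vanishes_Comp[OF vanishes_Diff[OF Suc.prems(1), simplified]])
      (use \<phi> in \<open>auto simp: kills_def\<close>)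
  then have 1: "vanishes n ((r \<cdot> Proj1 C Q (Q \<boxtimes> A)) \<cdot> (Proj1 C ?Q A \<cdot> Proj1 C (?Q \<boxtimes> A) A))
      (param_diff ?Q A ?\<phi>)"
    using \<phi> by (intro Suc.IH) auto
  have "vanishes n (?r \<cdot> Proj1 C ?W ?W) (param_diff ?Q A ?\<phi> \<cdot> ?e1)"
    by (rule vanishes_Comp[OF 1]) (use \<phi> in \<open>auto simp: kills_def\<close>)
  moreover have "vanishes n (?r \<cdot> Proj1 C ?W ?W) (param_diff Q A \<phi> \<cdot> ?e2)"
    by (rule vanishes_Comp[OF Suc.IH[OF vanishes_Suc[OF Suc.prems(1)]]])
      (use \<phi> in \<open>auto simp: kills_def\<close>)
  ultimately have "vanishes n (?r \<cdot> Proj1 C ?W ?W) (Diff C (param_diff Q A \<phi>))"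
    unfolding eq using \<phi> by (intro vanishes_Plus) auto
  moreover have "param_diff Q A \<phi> \<cdot> w = Zero C (src w) (tgt \<phi>)" if "kills ?r w" for w
  proof -
    have w: "arr w" "tgt w = ?W" using that \<phi> by (auto simp: kills_def)
    define q where "q = Proj1 C Q A \<cdot> (Proj1 C (Q \<boxtimes> A) A \<cdot> w)"
    define x where "x = Proj2 C Q A \<cdot> (Proj1 C (Q \<boxtimes> A) A \<cdot> w)"
    define y where "y = Proj2 C (Q \<boxtimes> A) A \<cdot> w"
    note defs = q_def x_def y_def
    have q: "arr q" "src q = src w" "tgt q = Q" and x: "arr x" "src x = src w" "tgt x = A"
      and y: "arr y" "src y = src w" "tgt y = A"
      using w by (simp_all add: defs)
    have w_eq: "w = \<langle>\<langle>q, x\<rangle>, y\<rangle>"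
      using w by (simp add: defs)
    have "r \<cdot> q = Zero C (src w) (tgt r)"
      using that w \<phi> by (simp add: kills_def q_def)
    moreover have "r \<cdot> (q \<cdot> Proj1 C (src w) A) = (r \<cdot> q) \<cdot> Proj1 C (src w) A"
      using q \<phi> by simp
    ultimately have "kills (r \<cdot> Proj1 C Q A) \<langle>q \<cdot> Proj1 C (src w) A, Proj2 C (src w) A\<rangle>"
      using q \<phi> by (simp add: kills_def)
    then have "\<phi> \<cdot> \<langle>q \<cdot> Proj1 C (src w) A, Proj2 C (src w) A\<rangle> = Zero C (src w \<boxtimes> A) (tgt \<phi>)"
      using vanishes_at[OF Suc.prems(1)] q by fastforce
    then have "Diff C (\<phi> \<cdot> \<langle>q \<cdot> Proj1 C (src w) A, Proj2 C (src w) A\<rangle>)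
          \<cdot> \<langle>\<langle>Id C (src w), x\<rangle>, \<langle>Zero C (src w) (src w), y\<rangle>\<rangle>
        = Zero C (src w) (tgt \<phi>)"
      using x y by simp
    then have "Diff C \<phi> \<cdot> \<langle>\<langle>q, x\<rangle>, \<langle>Zero C (src w) Q, y\<rangle>\<rangle> = Zero C (src w) (tgt \<phi>)"
      using q x y \<phi> by simp
    then show ?thesis
      unfolding w_eq using q x y \<phi> by (simp add: param_diff_def)
  qed
  ultimately show ?case using \<phi> by simp
qed simp

lemma diag_typing [simp]:
  assumes "arr b" "src b = Z"
  shows "arr (diag C Z b n)" "src (diag C Z b n) = Z"
    "tgt (diag C Z b n) = power_obj C (tgt b) n"
  using assms by (induction n) simp_all

lemma diag_Comp:
  assumes "arr b" "src b = Z" "arr x" "tgt x = Z"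
  shows "diag C Z b n \<cdot> x = diag C (src x) (b \<cdot> x) n"
  using assms by (induction n) simp_all

lemma nth_diff_typing [simp]:
  assumes "arr g" "src g = A"
  shows "arr (nth_diff C A g n)" "tgt (nth_diff C A g n) = tgt g"
    "src (nth_diff C A g n) = A \<boxtimes> power_obj C A n"
  using assms by (induction n) (simp_all add: Let_def)

lemma nth_diff_Suc_Pair:
  assumes "arr g" "src g = A" "arr a" "arr v" "arr b" "src v = src a" "src b = src a"
    "tgt a = A" "tgt v = power_obj C A n" "tgt b = A"
  shows "nth_diff C A g (Suc n) \<cdot> \<langle>a, \<langle>v, b\<rangle>\<rangle>
    = Diff C (nth_diff C A g n) \<cdot> \<langle>\<langle>a, v\<rangle>, \<langle>b, Zero C (src a) (power_obj C A n)\<rangle>\<rangle>"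
  using assms by (simp add: Let_def)

text \<open>
  Each of the \<open>m\<close> linear arguments contributes the order \<open>k\<close> of \<open>b\<close>. One more derivative of \<open>g\<close> is taken
  at the base point; treating the base point as a free parameter shows that this does not destroy the
  order \<open>m * k\<close> already obtained. The resulting map is linear in the new argument, whose order is
  then added.
\<close>

lemma vanishes_nth_diff_Pair:
  assumes "vanishes k r b" "arr g" "src g = A" "arr a" "arr b" "src a = E" "src b = E"
    "tgt a = A" "tgt b = A" "arr r" "src r = E"
  shows "vanishes (m * k) r (nth_diff C A g m \<cdot> \<langle>a, diag C E b m\<rangle>)"
  using assms
proof (induction m arbitrary: E a b r)
  case (Suc m)
  note b = Suc.prems(2-11)
  let ?d = "diag C E b m" and ?F = "nth_diff C A g m" and ?p = "Proj1 C E A" and ?q = "Proj2 C E A"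
  \<comment> \<open>the base point of the \<open>m\<close>-th derivative becomes the free variable \<open>?q\<close>\<close>
  let ?\<phi> = "?F \<cdot> \<langle>?q, ?d \<cdot> ?p\<rangle>"
  let ?\<psi> = "Diff C ?F \<cdot> \<langle>\<langle>a \<cdot> ?p, ?d \<cdot> ?p\<rangle>, \<langle>?q, Zero C (E \<boxtimes> A) (power_obj C A m)\<rangle>\<rangle>"
  have "vanishes k (r \<cdot> ?p) (b \<cdot> ?p)"
    by (rule vanishes_Comp[OF Suc.prems(1)]) (use b in \<open>auto simp: kills_def\<close>)
  then have "vanishes (m * k) (r \<cdot> ?p) (?F \<cdot> \<langle>?q, diag C (E \<boxtimes> A) (b \<cdot> ?p) m\<rangle>)"
    using b by (intro Suc.IH) auto
  then have "vanishes (m * k) (r \<cdot> ?p) ?\<phi>"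
    using b by (simp add: diag_Comp)
  then have "vanishes (m * k) (r \<cdot> (?p \<cdot> Proj1 C (E \<boxtimes> A) A)) (param_diff E A ?\<phi>)"
    using b by (intro vanishes_param_diff) auto
  then have "vanishes (m * k) (r \<cdot> ?p) (param_diff E A ?\<phi> \<cdot> \<langle>\<langle>?p, a \<cdot> ?p\<rangle>, ?q\<rangle>)"
    by (rule vanishes_Comp) (use b in \<open>auto simp: kills_def\<close>)
  moreover have "param_diff E A ?\<phi> \<cdot> \<langle>\<langle>?p, a \<cdot> ?p\<rangle>, ?q\<rangle> = ?\<psi>"
    using b by (simp add: param_diff_def)
  ultimately have "vanishes (m * k) (r \<cdot> ?p) ?\<psi>"
    by simp
  moreover have "linear_snd E A ?\<psi>"
    using b by (simp add: linear_snd_def)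
  ultimately have "vanishes (Suc m * k) r (?\<psi> \<cdot> \<langle>Id C E, b\<rangle>)"
    using b by (intro vanishes_linear_snd[OF _ _ Suc.prems(1)]) auto
  moreover have "?\<psi> \<cdot> \<langle>Id C E, b\<rangle> = nth_diff C A g (Suc m) \<cdot> \<langle>a, diag C E b (Suc m)\<rangle>"
    using b unfolding diag.simps by (subst nth_diff_Suc_Pair) auto
  ultimately show ?case by simp
qed simp

lemma nth_diff_diag_typing [simp]:
  assumes "arr g" "src g = A" "arr a" "arr b" "src a = Z" "src b = Z" "tgt a = A" "tgt b = A"
  shows "arr (nth_diff_diag C Z A g m a b)" "src (nth_diff_diag C Z A g m a b) = Z"
    "tgt (nth_diff_diag C Z A g m a b) = tgt g"
  using assms by (simp_all add: nth_diff_diag_def)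

lemma vanishes_nth_diff_diag:
  assumes "vanishes k r b" "arr g" "src g = A" "arr a" "arr b" "src a = Z" "src b = Z"
    "tgt a = A" "tgt b = A" "arr r" "src r = Z" "n \<le> m * k"
  shows "vanishes n r (nth_diff_diag C Z A g m a b)"
  unfolding nth_diff_diag_def
  by (rule vanishes_mono[OF vanishes_nth_diff_Pair[OF assms(1-11)] assms(12)])

lemma nth_diff_Plus:
  assumes "arr f" "arr g" "src f = A" "src g = A" "tgt g = tgt f"
  shows "nth_diff C A (f \<oplus> g) n = nth_diff C A f n \<oplus> nth_diff C A g n"
  using assms by (induction n) (simp_all add: Let_def)

lemma taylor_monomial_typing [simp]:
  assumes "arr f" "src f = A"
  shows "arr (taylor_monomial C A n f)" "src (taylor_monomial C A n f) = A"
    "tgt (taylor_monomial C A n f) = tgt f"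
  using assms by (simp_all add: taylor_monomial_def)

lemma taylor_monomial_Plus:
  assumes "arr f" "arr g" "src f = A" "src g = A" "tgt g = tgt f"
  shows "taylor_monomial C A n (f \<oplus> g) = taylor_monomial C A n f \<oplus> taylor_monomial C A n g"
  using assms by (simp add: taylor_monomial_def nth_diff_diag_def nth_diff_Plus)

lemma vanishes_Id: "vanishes 1 (Id C A) (Id C A)"
  by (auto simp: kills_def)

text \<open>
  Each differentiation costs one order. The directions need no control, since the tangent vectors in
  \<open>vanishes\<close> are arbitrary; so the locus only fixes the base point, and evaluation on the diagonal is
  covered.
\<close>

lemma vanishes_nth_diff:
  assumes "vanishes n (Id C A) g" "arr g" "src g = A" "m \<le> n"
  shows "vanishes (n - m) (Proj1 C A (power_obj C A m)) (nth_diff C A g m)"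
  using assms(4)
proof (induction m)
  case 0
  show ?case
    using vanishes_Comp[OF assms(1), of "Proj1 C A (One C)" "Proj1 C A (One C)"] assms
    by (simp add: kills_def)
next
  case (Suc m)
  let ?P = "power_obj C A m"
  let ?a = "Proj1 C A (?P \<boxtimes> A)" and ?r = "Proj2 C A (?P \<boxtimes> A)"
  let ?e = "\<langle>\<langle>?a, Proj1 C ?P A \<cdot> ?r\<rangle>, \<langle>Proj2 C ?P A \<cdot> ?r, Zero C (A \<boxtimes> (?P \<boxtimes> A)) ?P\<rangle>\<rangle>"
  have "vanishes (n - m - 1) (Proj1 C A ?P \<cdot> Proj1 C (A \<boxtimes> ?P) (A \<boxtimes> ?P)) (Diff C (nth_diff C A g m))"
    using vanishes_Diff[OF Suc.IH] assms Suc.prems by simp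
  then have "vanishes (n - m - 1) ?a (Diff C (nth_diff C A g m) \<cdot> ?e)"
    by (rule vanishes_Comp) (use assms in \<open>auto simp: kills_def\<close>)
  then show ?case by (simp add: Let_def)
qed

lemma taylor_monomial_vanishes:
  assumes "vanishes n (Id C A) g" "arr g" "src g = A" "m < n"
  shows "taylor_monomial C A m g = Zero C A (tgt g)"
proof -
  have "kills (Proj1 C A (power_obj C A m)) \<langle>Zero C A A, diag C A (Id C A) m\<rangle>"
    by (simp add: kills_def)
  then show ?thesis
    using vanishes_at[OF vanishes_nth_diff[OF assms(1-3)]] assms
    by (simp add: taylor_monomial_def nth_diff_diag_def)
qed

text \<open>
  A monomial of degree \<open>m\<close> is an \<open>m\<close>-linear map on the diagonal, and the identity has order one.
\<close>

lemma vanishes_taylor_monomial: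
  assumes "arr g" "src g = A" "n \<le> m"
  shows "vanishes n (Id C A) (taylor_monomial C A m g)"
  unfolding taylor_monomial_def
  using assms by (intro vanishes_nth_diff_diag[OF vanishes_Id]) auto

end

section \<open>Order, suprema and continuity of differentiation\<close>

context omega_cpo_enriched_category
begin

lemma chain_typing:
  assumes "is_omega_chain C A B s"
  shows "arr (s n)" "src (s n) = A" "tgt (s n) = B" "s n \<sqsubseteq> s (Suc n)"
  using assms by (auto simp: is_omega_chain_def in_Hom_iff)

lemma chainI:
  assumes "\<And>n. arr (s n)" "\<And>n. src (s n) = A" "\<And>n. tgt (s n) = B" "\<And>n. s n \<sqsubseteq> s (Suc n)"
  shows "is_omega_chain C A B s"
  using assms by (auto simp: is_omega_chain_def in_Hom_iff)

lemma chain_le: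
  assumes "is_omega_chain C A B s" "m \<le> n"
  shows "s m \<sqsubseteq> s n"
  using assms(2)
proof (induction n rule: dec_induct)
  case base
  show ?case using chain_typing[OF assms(1)] by (simp add: le_refl)
next
  case (step n)
  then show ?case using chain_typing(4)[OF assms(1)] le_trans by blast
qed

lemma sup_typing:
  assumes "is_omega_sup C A B s u"
  shows "is_omega_chain C A B s" "arr (s n)" "src (s n) = A" "tgt (s n) = B" "s n \<sqsubseteq> u"
    "arr u" "src u = A" "tgt u = B"
  using assms by (auto simp: is_omega_sup_def is_omega_chain_def in_Hom_iff)

lemma sup_least:
  assumes "is_omega_sup C A B s u" "\<And>n. s n \<sqsubseteq> v"
  shows "u \<sqsubseteq> v"
proof -
  have "v \<in> Hom C A B"
    using sup_typing[OF assms(1)] le_typing[OF assms(2)[of 0]] by (simp add: in_Hom_iff)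
  then show ?thesis using assms by (auto simp: is_omega_sup_def)
qed

lemma supI:
  assumes "is_omega_chain C A B s" "arr u" "src u = A" "tgt u = B" "\<And>n. s n \<sqsubseteq> u"
    and "\<And>v. (\<And>n. s n \<sqsubseteq> v) \<Longrightarrow> u \<sqsubseteq> v"
  shows "is_omega_sup C A B s u"
  using assms by (auto simp: is_omega_sup_def in_Hom_iff)

lemma sup_unique: "is_omega_sup C A B s u \<Longrightarrow> is_omega_sup C A B s v \<Longrightarrow> u = v"
  by (meson nat_le_antisym sup_least sup_typing(5))

lemma omega_sup_eq: "is_omega_sup C A B s u \<Longrightarrow> omega_sup C A B s = u"
  unfolding omega_sup_def using sup_unique by blast

lemma sup_const: "arr f \<Longrightarrow> src f = A \<Longrightarrow> tgt f = B \<Longrightarrow> is_omega_sup C A B (\<lambda>_. f) f"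
  by (rule supI[OF chainI]) (auto simp: le_refl)

lemma sup_shift:
  assumes "is_omega_sup C A B s u"
  shows "is_omega_sup C A B (\<lambda>n. s (n + k)) u"
proof (rule supI)
  show "is_omega_chain C A B (\<lambda>n. s (n + k))"
    using chain_typing[OF sup_typing(1)[OF assms]] by (intro chainI) auto
  fix v assume "\<And>n. s (n + k) \<sqsubseteq> v"
  then have "s n \<sqsubseteq> v" for n
    using le_trans[OF chain_le[OF sup_typing(1)[OF assms], of n "n + k"]] by simp
  then show "u \<sqsubseteq> v" by (rule sup_least[OF assms])
qed (use sup_typing[OF assms] in auto)

text \<open>
  An inequality is a chain that is constant after its first entry, so monotonicity is an instance of
  continuity.
\<close>

lemma Comp_mono:
  assumes "g \<sqsubseteq> g'" "f \<sqsubseteq> f'" "src g = tgt f"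
  shows "g \<cdot> f \<sqsubseteq> g' \<cdot> f'"
proof -
  have sup: "is_omega_sup C (src x) (tgt x) (\<lambda>n. if n = 0 then x else y) y" if "x \<sqsubseteq> y" for x y
  proof (rule supI[OF chainI])
    fix v assume v: "\<And>n. (if n = (0::nat) then x else y) \<sqsubseteq> v"
    show "y \<sqsubseteq> v" using v[of 1] by simp
  qed (use le_typing[OF that] that in \<open>auto simp: le_refl\<close>)
  show ?thesis
    using sup_typing(5)[OF Comp_continuous[OF sup[OF assms(1), unfolded assms(3)] sup[OF assms(2)]], of 0]
    by simp
qed

lemma le_Zero: "f \<sqsubseteq> Zero C A B \<Longrightarrow> f = Zero C A B"
  using Zero_bottom[of f A B] le_typing[of f "Zero C A B"] nat_le_antisym
  by (auto simp: in_Hom_iff)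

text \<open>
  Nothing nonzero lies below zero, so a summand of a vanishing sum vanishes. Hence the
  order of a sum is a lower bound for that of each summand even though summands cannot be cancelled.
\<close>

lemma vanishes_le:
  assumes "f \<sqsubseteq> g" "vanishes n r g" "arr r" "src r = src f"
  shows "vanishes n r f"
proof -
  obtain h where h: "arr f" "arr h" "src h = src f" "tgt h = tgt f" "g = f \<oplus> h"
    using assms(1) by (auto elim: leE)
  have "vanishes n r (f \<oplus> h)" using assms(2) h by simp
  with h(1-4) assms(3,4) show ?thesis
  proof (induction n arbitrary: r f h)
    case (Suc n)
    have "vanishes n (r \<cdot> Proj1 C (src f) (src f)) (Diff C f)"
      using Suc.prems by (intro Suc.IH[of "Diff C f" "Diff C h"]) auto
    moreover have "f \<cdot> w = Zero C (src w) (tgt f)" if "kills r w" for w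
    proof (rule le_Zero)
      have w: "arr w" "tgt w = src f" using that Suc.prems by (auto simp: kills_def)
      have "f \<cdot> w \<oplus> h \<cdot> w = Zero C (src w) (tgt f)"
        using Suc.prems that w by auto
      then show "f \<cdot> w \<sqsubseteq> Zero C (src w) (tgt f)"
        using le_add[of "f \<cdot> w" "h \<cdot> w"] w Suc.prems by simp
    qed
    ultimately show ?case by simp
  qed simp
qed

lemma Pair_mono:
  assumes "f \<sqsubseteq> f'" "g \<sqsubseteq> g'" "src g = src f"
  shows "\<langle>f, g\<rangle> \<sqsubseteq> \<langle>f', g'\<rangle>"
proof -
  obtain h where h: "arr f" "arr h" "src h = src f" "tgt h = tgt f" "f' = f \<oplus> h"
    using assms(1) by (auto elim: leE)
  obtain k where k: "arr g" "arr k" "src k = src g" "tgt k = tgt g" "g' = g \<oplus> k"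
    using assms(2) by (auto elim: leE)
  have "\<langle>f', g'\<rangle> = \<langle>f, g\<rangle> \<oplus> \<langle>h, k\<rangle>"
    unfolding h(5) k(5) using h(1-4) k(1-4) assms(3) by (intro Pair_Plus) auto
  then show ?thesis using h(1-4) k(1-4) assms(3) by (simp add: le_add)
qed

lemma Pair_continuous:
  assumes "is_omega_sup C Z A s u" "is_omega_sup C Z B t v"
  shows "is_omega_sup C Z (A \<boxtimes> B) (\<lambda>n. \<langle>s n, t n\<rangle>) \<langle>u, v\<rangle>"
proof (rule supI)
  note st = sup_typing[OF assms(1)] sup_typing[OF assms(2)]
  show "is_omega_chain C Z (A \<boxtimes> B) (\<lambda>n. \<langle>s n, t n\<rangle>)"
    using st chain_typing[OF st(1)] chain_typing[OF st(9)]
    by (intro chainI Pair_mono) auto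
  show "\<langle>s n, t n\<rangle> \<sqsubseteq> \<langle>u, v\<rangle>" for n
    using st by (intro Pair_mono) auto
  fix w assume w: "\<And>n. \<langle>s n, t n\<rangle> \<sqsubseteq> w"
  have w': "arr w" "src w = Z" "tgt w = A \<boxtimes> B"
    using le_typing[OF w] st by auto
  have "s n \<sqsubseteq> Proj1 C A B \<cdot> w" "t n \<sqsubseteq> Proj2 C A B \<cdot> w" for n
    using Comp_mono[OF le_refl w, of "Proj1 C A B"] Comp_mono[OF le_refl w, of "Proj2 C A B"] st
    by simp_all
  then have "\<langle>u, v\<rangle> \<sqsubseteq> \<langle>Proj1 C A B \<cdot> w, Proj2 C A B \<cdot> w\<rangle>"
    using st by (intro Pair_mono sup_least[OF assms(1)] sup_least[OF assms(2)]) auto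
  then show "\<langle>u, v\<rangle> \<sqsubseteq> w" using w' by simp
qed (use sup_typing[OF assms(1)] sup_typing[OF assms(2)] in auto)

lemma Eval_typing [simp]:
  "arr (Eval C A B)" "src (Eval C A B) = (A \<rightarrowtail> B) \<boxtimes> A" "tgt (Eval C A B) = B"
  using Eval_in_Hom[of A B] by (simp_all add: in_Hom_iff)

lemma Curry_typing [simp]:
  assumes "arr f" "src f = Z \<boxtimes> A"
  shows "arr (Curry C Z A f)" "src (Curry C Z A f) = Z" "tgt (Curry C Z A f) = A \<rightarrowtail> tgt f"
  using Curry_in_Hom[of f Z A "tgt f"] assms by (simp_all add: in_Hom_iff)

lemma Eval_Curry':
  assumes "arr f" "src f = Z \<boxtimes> A" "tgt f = B"
  shows "Eval C A B \<cdot> \<langle>Curry C Z A f \<cdot> Proj1 C Z A, Proj2 C Z A\<rangle> = f"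
  using Eval_Curry[of f Z A B] assms by (simp add: in_Hom_iff prod_Id_def)

lemma Eval_Curry_Pair:
  assumes "arr f" "src f = Z \<boxtimes> A" "tgt f = B" "arr z" "arr a" "tgt z = Z" "tgt a = A" "src a = src z"
  shows "Eval C A B \<cdot> \<langle>Curry C Z A f \<cdot> z, a\<rangle> = f \<cdot> \<langle>z, a\<rangle>"
proof -
  have "Eval C A B \<cdot> \<langle>Curry C Z A f \<cdot> z, a\<rangle>
      = (Eval C A B \<cdot> \<langle>Curry C Z A f \<cdot> Proj1 C Z A, Proj2 C Z A\<rangle>) \<cdot> \<langle>z, a\<rangle>"
    using assms by simp
  then show ?thesis unfolding Eval_Curry'[OF assms(1-3)] .
qed

lemma Curry_Eval':
  assumes "arr g" "src g = Z" "tgt g = A \<rightarrowtail> B"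
  shows "Curry C Z A (Eval C A B \<cdot> \<langle>g \<cdot> Proj1 C Z A, Proj2 C Z A\<rangle>) = g"
  using Curry_Eval[of g Z A B] assms by (simp add: in_Hom_iff prod_Id_def)

text \<open>
  Evaluation equals its own derivative in the function argument, and derivatives are additive in their
  direction.
\<close>

lemma Eval_Plus:
  assumes "arr g" "arr h" "arr a" "src h = src g" "src a = src g"
    "tgt g = A \<rightarrowtail> B" "tgt h = A \<rightarrowtail> B" "tgt a = A"
  shows "Eval C A B \<cdot> \<langle>g \<oplus> h, a\<rangle> = Eval C A B \<cdot> \<langle>g, a\<rangle> \<oplus> Eval C A B \<cdot> \<langle>h, a\<rangle>"
proof -
  have D: "Diff C (Eval C A B) \<cdot> \<langle>\<langle>g, a\<rangle>, \<langle>x, Zero C (src g) A\<rangle>\<rangle> = Eval C A B \<cdot> \<langle>x, a\<rangle>"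
    if "arr x" "src x = src g" "tgt x = A \<rightarrowtail> B" for x
    using Diff_Eval[of g "src g" A B a x] that assms by (simp add: in_Hom_iff)
  have "\<langle>g \<oplus> h, Zero C (src g) A\<rangle> = \<langle>g, Zero C (src g) A\<rangle> \<oplus> \<langle>h, Zero C (src g) A\<rangle>"
    using Pair_Plus[of g "Zero C (src g) A" h "Zero C (src g) A"] assms by simp
  then have "Diff C (Eval C A B) \<cdot> \<langle>\<langle>g, a\<rangle>, \<langle>g \<oplus> h, Zero C (src g) A\<rangle>\<rangle>
      = Diff C (Eval C A B) \<cdot> \<langle>\<langle>g, a\<rangle>, \<langle>g, Zero C (src g) A\<rangle>\<rangle>
        \<oplus> Diff C (Eval C A B) \<cdot> \<langle>\<langle>g, a\<rangle>, \<langle>h, Zero C (src g) A\<rangle>\<rangle>"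
    using assms by (simp only:) (subst Diff_dir_Plus; simp)
  then show ?thesis using assms D[of g] D[of h] D[of "g \<oplus> h"] by simp
qed

lemma Curry_mono:
  assumes "f \<sqsubseteq> g" "src f = Z \<boxtimes> A"
  shows "Curry C Z A f \<sqsubseteq> Curry C Z A g"
proof -
  obtain h where h: "arr f" "arr h" "src h = src f" "tgt h = tgt f" "g = f \<oplus> h"
    using assms(1) by (auto elim: leE)
  let ?cf = "Curry C Z A f" and ?ch = "Curry C Z A h"
  have "Eval C A (tgt f) \<cdot> \<langle>(?cf \<oplus> ?ch) \<cdot> Proj1 C Z A, Proj2 C Z A\<rangle> = g"
    using h assms Eval_Curry'[of f Z A "tgt f"] Eval_Curry'[of h Z A "tgt f"]
    by (simp add: Eval_Plus)
  then have "Curry C Z A g = ?cf \<oplus> ?ch"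
    using Curry_Eval'[of "?cf \<oplus> ?ch" Z A "tgt f"] h(1-4) assms(2) by simp
  then show ?thesis using h(1-4) assms(2) le_add[of ?cf ?ch] by simp
qed

text \<open>
  Currying is an order isomorphism of hom-sets: it is monotone, and so is its inverse, which composes
  with evaluation.
\<close>

lemma Curry_continuous:
  assumes "is_omega_sup C (Z \<boxtimes> A) B s u"
  shows "is_omega_sup C Z (A \<rightarrowtail> B) (\<lambda>n. Curry C Z A (s n)) (Curry C Z A u)"
proof (rule supI)
  note st = sup_typing[OF assms(1)]
  show "is_omega_chain C Z (A \<rightarrowtail> B) (\<lambda>n. Curry C Z A (s n))"
    using st chain_typing[OF st(1)] by (intro chainI Curry_mono) auto
  show "Curry C Z A (s n) \<sqsubseteq> Curry C Z A u" for n
    using st by (intro Curry_mono) auto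
  fix w assume w: "\<And>n. Curry C Z A (s n) \<sqsubseteq> w"
  have w': "arr w" "src w = Z" "tgt w = A \<rightarrowtail> B"
    using le_typing[OF w] st by auto
  let ?w = "Eval C A B \<cdot> \<langle>w \<cdot> Proj1 C Z A, Proj2 C Z A\<rangle>"
  have "Eval C A B \<cdot> \<langle>Curry C Z A (s n) \<cdot> Proj1 C Z A, Proj2 C Z A\<rangle> \<sqsubseteq> ?w" for n
    using st w by (intro Comp_mono Pair_mono le_refl) auto
  then have "s n \<sqsubseteq> ?w" for n
    using st by (simp add: Eval_Curry')
  then have "Curry C Z A u \<sqsubseteq> Curry C Z A ?w"
    using st by (intro Curry_mono sup_least[OF assms]) auto
  then show "Curry C Z A u \<sqsubseteq> w" using Curry_Eval'[OF w'] by simp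
qed (use sup_typing[OF assms(1)] in auto)

text \<open>
  Here \<open>f\<close> is evaluation applied to its own name, a constant map. The name occurs in the derivative only
  as an argument of a fixed map, so differentiation is a composite of continuous operations.
\<close>

lemma Diff_via_Eval:
  assumes "arr f" "src f = A" "tgt f = B"
  shows "Diff C f = Diff C (Eval C A B) \<cdot>
    \<langle>\<langle>Curry C (One C) A (f \<cdot> Proj2 C (One C) A) \<cdot> Zero C (A \<boxtimes> A) (One C), Proj1 C A A\<rangle>,
     \<langle>Zero C (A \<boxtimes> A) (A \<rightarrowtail> B), Proj2 C A A\<rangle>\<rangle>"
proof -
  let ?c = "Curry C (One C) A (f \<cdot> Proj2 C (One C) A)"
  have "f = Eval C A B \<cdot> \<langle>?c \<cdot> Zero C A (One C), Id C A\<rangle>"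
    using assms by (subst Eval_Curry_Pair) auto
  then have "Diff C f = Diff C (Eval C A B \<cdot> \<langle>?c \<cdot> Zero C A (One C), Id C A\<rangle>)"
    by (rule arg_cong)
  also have "\<dots> = Diff C (Eval C A B) \<cdot>
    \<langle>\<langle>?c \<cdot> Zero C (A \<boxtimes> A) (One C), Proj1 C A A\<rangle>, \<langle>Zero C (A \<boxtimes> A) (A \<rightarrowtail> B), Proj2 C A A\<rangle>\<rangle>"
    using assms by simp
  finally show ?thesis .
qed

lemma Diff_continuous:
  assumes "is_omega_sup C A B s u"
  shows "is_omega_sup C (A \<boxtimes> A) B (\<lambda>n. Diff C (s n)) (Diff C u)"
proof -
  note st = sup_typing[OF assms]
  let ?D = "\<lambda>f. Diff C (Eval C A B) \<cdot>
    \<langle>\<langle>Curry C (One C) A (f \<cdot> Proj2 C (One C) A) \<cdot> Zero C (A \<boxtimes> A) (One C), Proj1 C A A\<rangle>,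
     \<langle>Zero C (A \<boxtimes> A) (A \<rightarrowtail> B), Proj2 C A A\<rangle>\<rangle>"
  have "is_omega_sup C (A \<boxtimes> A) B (\<lambda>n. ?D (s n)) (?D u)"
    by (rule Comp_continuous Pair_continuous Curry_continuous assms | rule sup_const; simp)+
  then show ?thesis using st by (simp add: Diff_via_Eval[of _ A B])
qed

lemma vanishes_sup:
  assumes "is_omega_sup C A B s u" "\<And>m. vanishes n r (s m)" "arr r" "src r = A"
  shows "vanishes n r u"
  using assms
proof (induction n arbitrary: r s u A)
  case (Suc n)
  note st = sup_typing[OF Suc.prems(1)]
  have "vanishes n (r \<cdot> Proj1 C A A) (Diff C u)"
  proof (rule Suc.IH[OF Diff_continuous[OF Suc.prems(1)]])
    show "vanishes n (r \<cdot> Proj1 C A A) (Diff C (s m))" for m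
      using Suc.prems(2)[of m] st by simp
  qed (use Suc.prems in auto)
  moreover have "u \<cdot> w = Zero C (src w) B" if w: "kills r w" for w
  proof (rule le_Zero)
    have wt: "arr w" "tgt w = A" using w Suc.prems by (auto simp: kills_def)
    have "s m \<cdot> w = Zero C (src w) B" for m
      using Suc.prems(2)[of m] w st by auto
    then show "u \<cdot> w \<sqsubseteq> Zero C (src w) B"
      using sup_least[OF Comp_continuous[OF Suc.prems(1) sup_const[OF wt(1) refl wt(2)]]]
      by (simp add: le_refl)
  qed
  ultimately show ?case using st by simp
qed simp

lemma monus_is_monus:
  assumes "arr f" "arr g" "src f = A" "src g = A" "tgt f = B" "tgt g = B"
  shows "is_monus C A B f g (monus C A B f g)"
proof -
  obtain d where d: "is_monus C A B f g d"
    using monus_exists[of f A B g] assms by (auto simp: in_Hom_iff)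
  have uniq: "e = d" if e: "is_monus C A B f g e" for e
  proof (rule nat_le_antisym)
    have "d \<sqsubseteq> d" "e \<sqsubseteq> e" using d e by (auto simp: is_monus_def in_Hom_iff le_refl)
    then show "e \<sqsubseteq> d" "d \<sqsubseteq> e" using d e by (auto simp: is_monus_def)
  qed
  show ?thesis unfolding monus_def by (rule theI[where P = "is_monus C A B f g", OF d uniq])
qed

lemma monus_typing [simp]:
  assumes "arr f" "arr g" "src f = A" "src g = A" "tgt f = B" "tgt g = B"
  shows "arr (monus C A B f g)" "src (monus C A B f g) = A" "tgt (monus C A B f g) = B"
  using monus_is_monus[OF assms] by (auto simp: is_monus_def in_Hom_iff)

lemma monus_le_iff:
  assumes "arr f" "arr g" "arr h" "src f = A" "src g = A" "src h = A"
    "tgt f = B" "tgt g = B" "tgt h = B"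
  shows "monus C A B f g \<sqsubseteq> h \<longleftrightarrow> f \<sqsubseteq> g \<oplus> h"
  using monus_is_monus[of f g A B] assms by (auto simp: is_monus_def in_Hom_iff)

lemma Plus_monus:
  assumes "g \<sqsubseteq> f" "src f = A" "tgt f = B"
  shows "g \<oplus> monus C A B f g = f"
proof (rule nat_le_antisym)
  obtain h where h: "arr f" "arr g" "src g = A" "tgt g = B" "arr h" "src h = A" "tgt h = B" "f = g \<oplus> h"
    using leE[OF assms(1)] unfolding assms(2,3) by metis
  let ?d = "monus C A B f g"
  have d: "arr ?d" "src ?d = A" "tgt ?d = B"
    using h(1-4) assms by simp_all
  show "f \<sqsubseteq> g \<oplus> ?d"
    using monus_le_iff[of f g ?d A B] h(1-4) d assms(2,3) le_refl[OF d(1)] by blast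
  have "?d \<sqsubseteq> h"
    using monus_le_iff[of f g h A B] h(1-7) assms(2,3) le_refl[OF h(1)] unfolding h(8)[symmetric]
    by blast
  then have "g \<oplus> ?d \<sqsubseteq> g \<oplus> h"
    using h(1-7) d by (intro Plus_mono le_refl) auto
  then show "g \<oplus> ?d \<sqsubseteq> f" using h(8) by simp
qed

end

section \<open>Taylor expansion\<close>

context taylor_category
begin

lemma nat_mult_typing [simp]:
  assumes "arr f" "src f = A" "tgt f = B"
  shows "arr (nat_mult C A B k f)" "src (nat_mult C A B k f) = A" "tgt (nat_mult C A B k f) = B"
  using assms by (induction k) simp_all

lemma nat_mult_Plus:
  assumes "arr f" "arr g" "src f = A" "src g = A" "tgt f = B" "tgt g = B"
  shows "nat_mult C A B k (f \<oplus> g) = nat_mult C A B k f \<oplus> nat_mult C A B k g"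
proof (induction k)
  case (Suc k)
  let ?a = "nat_mult C A B k f" and ?b = "nat_mult C A B k g"
  have "(?a \<oplus> ?b) \<oplus> (f \<oplus> g) = (?a \<oplus> f) \<oplus> (?b \<oplus> g)"
    using assms by (simp add: Plus_ac)
  then show ?case using Suc.IH by simp
qed simp

lemma inv_fact_mult_spec:
  assumes "arr f" "src f = A" "tgt f = B"
  shows "inv_fact_mult C A B n f \<in> Hom C A B"
    "nat_mult C A B (fact n) (inv_fact_mult C A B n f) = f"
  using theI'[OF fact_divisible[of f A B n]] assms by (auto simp: inv_fact_mult_def in_Hom_iff)

lemma inv_fact_mult_typing [simp]:
  assumes "arr f" "src f = A" "tgt f = B"
  shows "arr (inv_fact_mult C A B n f)" "src (inv_fact_mult C A B n f) = A"
    "tgt (inv_fact_mult C A B n f) = B"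
  using inv_fact_mult_spec(1)[OF assms] by (auto simp: in_Hom_iff)

lemma inv_fact_mult_unique:
  assumes "arr g" "src g = A" "tgt g = B" "nat_mult C A B (fact n) g = f"
  shows "inv_fact_mult C A B n f = g"
proof -
  have "f \<in> Hom C A B" using assms by (auto simp: in_Hom_iff)
  then show ?thesis
    unfolding inv_fact_mult_def using assms
    by (intro the1_equality[OF fact_divisible]) (simp_all add: in_Hom_iff)
qed

lemma inv_fact_mult_le_one:
  assumes "arr f" "src f = A" "tgt f = B" "n \<le> 1"
  shows "inv_fact_mult C A B n f = f"
proof (rule inv_fact_mult_unique)
  have "fact n = (1 :: nat)" using assms(4) by (cases n) auto
  then show "nat_mult C A B (fact n) f = f" using assms by simp
qed (use assms in auto)

lemma inv_fact_mult_Plus: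
  assumes "arr f" "arr g" "src f = A" "src g = A" "tgt f = B" "tgt g = B"
  shows "inv_fact_mult C A B n (f \<oplus> g) = inv_fact_mult C A B n f \<oplus> inv_fact_mult C A B n g"
  by (rule inv_fact_mult_unique) (use assms in \<open>simp_all add: nat_mult_Plus inv_fact_mult_spec\<close>)

lemma inv_fact_mult_le:
  assumes "arr f" "src f = A" "tgt f = B"
  shows "inv_fact_mult C A B n f \<sqsubseteq> f"
proof -
  let ?g = "inv_fact_mult C A B n f"
  obtain k where k: "fact n = Suc k"
    using gr0_implies_Suc[OF fact_gt_zero[of n, where 'a = nat]] by auto
  have "?g \<sqsubseteq> ?g \<oplus> nat_mult C A B k ?g"
    using assms by (intro le_add) auto
  also have "?g \<oplus> nat_mult C A B k ?g = f"
    using inv_fact_mult_spec(2)[OF assms, of n] assms unfolding k by (simp add: Plus_ac)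
  finally show ?thesis .
qed

lemma partial_sum_typing [simp]:
  assumes "\<And>n. arr (t n)" "\<And>n. src (t n) = A" "\<And>n. tgt (t n) = B"
  shows "arr (partial_sum C A B t n)" "src (partial_sum C A B t n) = A" "tgt (partial_sum C A B t n) = B"
  using assms by (induction n) simp_all

lemma partial_sum_chain:
  assumes "\<And>n. arr (t n)" "\<And>n. src (t n) = A" "\<And>n. tgt (t n) = B"
  shows "is_omega_chain C A B (partial_sum C A B t)"
  using assms by (intro chainI) (auto intro!: le_add)

lemma partial_sum_Plus:
  assumes "\<And>n. arr (t n)" "\<And>n. src (t n) = A" "\<And>n. tgt (t n) = B"
    and "\<And>n. arr (s n)" "\<And>n. src (s n) = A" "\<And>n. tgt (s n) = B"
  shows "partial_sum C A B (\<lambda>n. t n \<oplus> s n) n = partial_sum C A B t n \<oplus> partial_sum C A B s n"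
proof (induction n)
  case (Suc n)
  let ?a = "partial_sum C A B t n" and ?b = "partial_sum C A B s n"
  have "(?a \<oplus> ?b) \<oplus> (t n \<oplus> s n) = (?a \<oplus> t n) \<oplus> (?b \<oplus> s n)"
    using assms by (simp add: Plus_ac)
  then show ?case using Suc.IH by simp
qed simp

lemma partial_sum_split:
  assumes "\<And>n. arr (t n)" "\<And>n. src (t n) = A" "\<And>n. tgt (t n) = B"
  shows "partial_sum C A B t (n + k)
    = partial_sum C A B t k \<oplus> partial_sum C A B (\<lambda>n. t (n + k)) n"
proof (induction n)
  case (Suc n)
  then show ?case using assms by (simp add: Plus_monoid(1))
qed (use assms in simp)

lemma sum_sup_exists:
  assumes "\<And>n. arr (t n)" "\<And>n. src (t n) = A" "\<And>n. tgt (t n) = B"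
  obtains u where "is_omega_sup C A B (partial_sum C A B t) u"
  using omega_sup_exists[OF partial_sum_chain[of t A B, OF assms]] by auto

lemma vanishes_sum:
  assumes "is_omega_sup C A B (partial_sum C A B t) u"
    and "\<And>n. arr (t n)" "\<And>n. src (t n) = A" "\<And>n. tgt (t n) = B"
    and "\<And>m. vanishes n r (t m)" "arr r" "src r = A"
  shows "vanishes n r u"
proof (rule vanishes_sup[OF assms(1)])
  show "vanishes n r (partial_sum C A B t m)" for m
    using assms(2-) by (induction m) (auto intro!: vanishes_Zero vanishes_Plus)
qed (use assms in auto)

text \<open>
  The remainder collects the Taylor terms of degree at least two. Each of them is multilinear in at
  least two copies of \<open>b\<close>, which doubles the order.
\<close>

lemma taylor_second_order:
  assumes "arr f" "src f = B" "arr a" "arr b" "src a = A" "src b = A" "tgt a = B" "tgt b = B"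
  obtains R where "arr R" "src R = A" "tgt R = tgt f"
    "f \<cdot> (a \<oplus> b) = (f \<cdot> a \<oplus> Diff C f \<cdot> \<langle>a, b\<rangle>) \<oplus> R"
    "\<And>k r. vanishes k r b \<Longrightarrow> arr r \<Longrightarrow> src r = A \<Longrightarrow> vanishes (2 * k) r R"
proof -
  let ?E = "tgt f"
  define t where "t = (\<lambda>n. inv_fact_mult C A ?E n (nth_diff_diag C A B f n a b))"
  have t: "arr (t n)" "src (t n) = A" "tgt (t n) = ?E" for n
    using assms by (simp_all add: t_def)
  have sup: "is_omega_sup C A ?E (partial_sum C A ?E t) (f \<cdot> (a \<oplus> b))"
    using Taylor[of f B ?E a A b] assms by (simp add: in_Hom_iff t_def)
  obtain R where R: "is_omega_sup C A ?E (partial_sum C A ?E (\<lambda>n. t (n + 2))) R"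
    using sum_sup_exists[of "\<lambda>n. t (n + 2)" A ?E] t by auto
  have t0: "t 0 = f \<cdot> a"
    using assms by (simp add: t_def inv_fact_mult_le_one nth_diff_diag_def)
  have t1: "t 1 = Diff C f \<cdot> \<langle>a, b\<rangle>"
    using assms by (simp add: t_def inv_fact_mult_le_one nth_diff_diag_def Let_def)
  have "partial_sum C A ?E t 2 = f \<cdot> a \<oplus> Diff C f \<cdot> \<langle>a, b\<rangle>"
    using assms t0 t1 by (simp add: numeral_2_eq_2)
  then have "(\<lambda>n. partial_sum C A ?E t (n + 2))
      = (\<lambda>n. (f \<cdot> a \<oplus> Diff C f \<cdot> \<langle>a, b\<rangle>) \<oplus> partial_sum C A ?E (\<lambda>n. t (n + 2)) n)"
    by (simp only: partial_sum_split[of t A ?E _ 2, OF t])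
  then have "is_omega_sup C A ?E (\<lambda>n. partial_sum C A ?E t (n + 2))
      ((f \<cdot> a \<oplus> Diff C f \<cdot> \<langle>a, b\<rangle>) \<oplus> R)"
    using assms by (simp only:) (intro Plus_continuous[OF sup_const R]; simp)
  then have "f \<cdot> (a \<oplus> b) = (f \<cdot> a \<oplus> Diff C f \<cdot> \<langle>a, b\<rangle>) \<oplus> R"
    using sup_unique[OF sup_shift[OF sup, of 2]] by blast
  moreover have "vanishes (2 * k) r R" if "vanishes k r b" "arr r" "src r = A" for k r
  proof (rule vanishes_sum[OF R])
    fix m
    have le: "2 * k \<le> (m + 2) * k" by simp
    have "vanishes (2 * k) r (nth_diff_diag C A B f (m + 2) a b)"
      by (rule vanishes_nth_diff_diag[OF that(1) _ _ _ _ _ _ _ _ _ _ le]) (use assms that in auto)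
    then show "vanishes (2 * k) r (t (m + 2))"
      unfolding t_def using assms that
      by (intro vanishes_le[OF inv_fact_mult_le]) auto
  qed (use t that in auto)
  moreover have "arr R" "src R = A" "tgt R = ?E" using sup_typing[OF R] by auto
  ultimately show thesis using that by blast
qed

lemma taylor_monomial_expansion:
  assumes "arr f" "src f = A" "tgt f = B"
  shows "is_omega_sup C A B
    (partial_sum C A B (\<lambda>n. inv_fact_mult C A B n (taylor_monomial C A n f))) f"
  using Taylor[of f A B "Zero C A A" A "Id C A"] assms
  by (simp add: in_Hom_iff taylor_monomial_def)

text \<open>
  Without cancellation, agreement of the monomials of \<open>z\<close> and \<open>z \<oplus> h\<close> below degree \<open>k\<close> does not force
  those of \<open>h\<close> to be zero, as addition could be idempotent. They can however be dropped: below degree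
  \<open>k\<close> the monomials of \<open>z\<close> already are the monomials of the sum.
\<close>

lemma high_order_difference:
  assumes "arr z" "arr h" "src z = A" "src h = A" "tgt z = B" "tgt h = B"
    and "\<And>i. i < k \<Longrightarrow> taylor_monomial C A i z = taylor_monomial C A i (z \<oplus> h)"
  obtains h' where "arr h'" "src h' = A" "tgt h' = B" "z \<oplus> h' = z \<oplus> h" "vanishes k (Id C A) h'"
proof -
  let ?M = "\<lambda>f n. inv_fact_mult C A B n (taylor_monomial C A n f)"
  define t where "t = (\<lambda>n. if n < k then Zero C A B else ?M h n)"
  have t: "arr (t n)" "src (t n) = A" "tgt (t n) = B" for n
    using assms by (simp_all add: t_def)
  obtain h' where h': "is_omega_sup C A B (partial_sum C A B t) h'"
    using sum_sup_exists[of t A B] t by auto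
  have "?M z n \<oplus> t n = ?M (z \<oplus> h) n" for n
  proof (cases "n < k")
    case True
    then show ?thesis using assms(1-6) assms(7)[OF True, symmetric] by (simp add: t_def)
  next
    case False
    then show ?thesis using assms(1-6) by (simp add: t_def taylor_monomial_Plus inv_fact_mult_Plus)
  qed
  then have "is_omega_sup C A B (partial_sum C A B (?M (z \<oplus> h))) (z \<oplus> h')"
    using Plus_continuous[OF taylor_monomial_expansion[of z A B] h'] assms(1-6) t
    by (simp flip: partial_sum_Plus)
  then have "z \<oplus> h' = z \<oplus> h"
    using sup_unique[OF _ taylor_monomial_expansion[of "z \<oplus> h" A B]] assms(1-6) by simp
  moreover have "vanishes k (Id C A) h'"
  proof (rule vanishes_sum[OF h'])
    show "vanishes k (Id C A) (t n)" for n
      using assms(1-6) unfolding t_def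
      by (auto intro!: vanishes_Zero vanishes_le[OF inv_fact_mult_le] vanishes_taylor_monomial)
  qed (use t in auto)
  ultimately show thesis using that[of h'] sup_typing[OF h'] by auto
qed

end

section \<open>Newton approximants\<close>

context newton_category
begin

primrec kleene where
  "kleene A X F 0 = Zero C A X"
| "kleene A X F (Suc n) = F \<cdot> \<langle>Id C A, kleene A X F n\<rangle>"

lemma kleene_typing [simp]:
  assumes "arr F" "src F = A \<boxtimes> X" "tgt F = X"
  shows "arr (kleene A X F n)" "src (kleene A X F n) = A" "tgt (kleene A X F n) = X"
  using assms by (induction n) simp_all

lemma Fix_typing [simp]:
  assumes "arr F" "src F = A \<boxtimes> X" "tgt F = X"
  shows "arr (Fix C A X F)" "src (Fix C A X F) = A" "tgt (Fix C A X F) = X"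
  using Fix_in_Hom[of F A X] assms by (simp_all add: in_Hom_iff)

lemma Fix_unfold:
  assumes "arr F" "src F = A \<boxtimes> X" "tgt F = X"
  shows "F \<cdot> \<langle>Id C A, Fix C A X F\<rangle> = Fix C A X F"
  using Fix_fixpoint[of F A X] assms by (simp add: in_Hom_iff)

text \<open>
  By naturality a fixpoint is the fixpoint combinator applied to the name of \<open>F\<close>, so the iterates of the
  combinator become those of \<open>F\<close>.
\<close>

lemma Fix_sup_kleene:
  assumes "arr F" "src F = A \<boxtimes> X" "tgt F = X"
  shows "is_omega_sup C A X (kleene A X F) (Fix C A X F)"
proof -
  let ?c = "Curry C A X F"
  have c: "arr ?c" "src ?c = A" "tgt ?c = X \<rightarrowtail> X"
    using assms by simp_all
  have approx: "arr (fix_comb_approx C X n)" "src (fix_comb_approx C X n) = X \<rightarrowtail> X"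
    "tgt (fix_comb_approx C X n) = X" for n
    by (induction n) simp_all
  have "fix_comb_approx C X n \<cdot> ?c = kleene A X F n" for n
  proof (induction n)
    case (Suc n)
    have "Eval C X X \<cdot> \<langle>?c \<cdot> Id C A, kleene A X F n\<rangle> = F \<cdot> \<langle>Id C A, kleene A X F n\<rangle>"
      using assms by (intro Eval_Curry_Pair) auto
    then show ?case using Suc.IH c approx by simp
  qed (use c in simp)
  then show ?thesis
    using Comp_continuous[OF fix_comb_sup sup_const[OF c]] Fix_eq_fix_comb[of F A X] assms
    by (simp add: in_Hom_iff)
qed

lemma taylor_second_order_snd:
  assumes "arr F" "src F = A \<boxtimes> X" "arr z" "arr h" "src z = A" "src h = A" "tgt z = X" "tgt h = X"
  obtains R where "arr R" "src R = A" "tgt R = tgt F"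
    "F \<cdot> \<langle>Id C A, z \<oplus> h\<rangle> = (F \<cdot> \<langle>Id C A, z\<rangle> \<oplus> partial2 C A A F (Id C A) z h) \<oplus> R"
    "\<And>k. vanishes k (Id C A) h \<Longrightarrow> vanishes (2 * k) (Id C A) R"
proof -
  have eq: "\<langle>Id C A, z\<rangle> \<oplus> \<langle>Zero C A A, h\<rangle> = \<langle>Id C A, z \<oplus> h\<rangle>"
    using Pair_Plus[of "Id C A" z "Zero C A A" h] assms by simp
  obtain R where R: "arr R" "src R = A" "tgt R = tgt F"
    "F \<cdot> (\<langle>Id C A, z\<rangle> \<oplus> \<langle>Zero C A A, h\<rangle>)
      = (F \<cdot> \<langle>Id C A, z\<rangle> \<oplus> Diff C F \<cdot> \<langle>\<langle>Id C A, z\<rangle>, \<langle>Zero C A A, h\<rangle>\<rangle>) \<oplus> R"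
    "\<And>k r. vanishes k r \<langle>Zero C A A, h\<rangle> \<Longrightarrow> arr r \<Longrightarrow> src r = A \<Longrightarrow> vanishes (2 * k) r R"
    by (rule taylor_second_order[of F "A \<boxtimes> X" "\<langle>Id C A, z\<rangle>" "\<langle>Zero C A A, h\<rangle>" A])
      (use assms in simp_all)
  have "vanishes (2 * k) (Id C A) R" if "vanishes k (Id C A) h" for k
  proof (rule R(5))
    have "linear_snd A X \<langle>Zero C (A \<boxtimes> X) A, Proj2 C A X\<rangle>"
      by (simp add: linear_snd_def)
    then have "vanishes k (Id C A) (\<langle>Zero C (A \<boxtimes> X) A, Proj2 C A X\<rangle> \<cdot> \<langle>Id C A, h\<rangle>)"
      by (rule vanishes_linear_snd[where l = 0, OF _ _ that]) (use assms in auto)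
    then show "vanishes k (Id C A) \<langle>Zero C A A, h\<rangle>"
      using assms by simp
  qed simp_all
  then show thesis
    using R(4) unfolding eq by (intro that[OF R(1-3)]) (auto simp: partial2_def)
qed

lemma linear_snd_partial2:
  assumes "arr F" "src F = A \<boxtimes> X" "arr z" "src z = A" "tgt z = X"
  shows "linear_snd A X (Diff C F \<cdot> \<langle>\<langle>Proj1 C A X, z \<cdot> Proj1 C A X\<rangle>, \<langle>Zero C (A \<boxtimes> X) A, Proj2 C A X\<rangle>\<rangle>)"
  using assms by (simp add: linear_snd_def)

lemma partial2_typing [simp]:
  assumes "arr F" "src F = A \<boxtimes> X" "arr a" "arr z" "arr y" "src a = Z" "src z = Z" "src y = Z"
    "tgt a = A" "tgt z = X" "tgt y = X"
  shows "arr (partial2 C Z A F a z y)" "src (partial2 C Z A F a z y) = Z"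
    "tgt (partial2 C Z A F a z y) = tgt F"
  using assms by (simp_all add: partial2_def)

lemma vanishes_partial2:
  assumes "vanishes k (Id C A) h" "arr F" "src F = A \<boxtimes> X" "arr z" "src z = A" "tgt z = X"
    "arr h" "src h = A" "tgt h = X"
  shows "vanishes k (Id C A) (partial2 C A A F (Id C A) z h)"
  using vanishes_linear_snd[where l = 0 and n = k, OF linear_snd_partial2[OF assms(2-6)] _ assms(1)] assms
  by (simp add: partial2_def)

lemma partial2_Plus:
  assumes "arr F" "src F = A \<boxtimes> X" "arr a" "arr z" "arr x" "arr y"
    "src a = Z" "src z = Z" "src x = Z" "src y = Z" "tgt a = A" "tgt z = X" "tgt x = X" "tgt y = X"
  shows "partial2 C Z A F a z (x \<oplus> y) = partial2 C Z A F a z x \<oplus> partial2 C Z A F a z y"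
proof -
  have "\<langle>Zero C Z A, x \<oplus> y\<rangle> = \<langle>Zero C Z A, x\<rangle> \<oplus> \<langle>Zero C Z A, y\<rangle>"
    using Pair_Plus[of "Zero C Z A" x "Zero C Z A" y] assms by simp
  then show ?thesis
    unfolding partial2_def using assms by (simp only:) (subst Diff_dir_Plus; simp)
qed

text \<open>
  Names the map whose fixpoint the repetition operator takes, so that facts about fixpoints
  apply to the Newton correction.
\<close>

lemma repetition_eq_Fix:
  assumes "arr F" "src F = A \<boxtimes> X" "tgt F = X" "arr z" "src z = A" "tgt z = X"
    "arr b" "src b = A" "tgt b = X"
  obtains G where "arr G" "src G = A \<boxtimes> X" "tgt G = X" "repetition C A X F z b = Fix C A X G"
    "\<And>y. arr y \<Longrightarrow> src y = A \<Longrightarrow> tgt y = X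
      \<Longrightarrow> G \<cdot> \<langle>Id C A, y\<rangle> = b \<oplus> partial2 C A A F (Id C A) z y"
proof
  let ?G = "b \<cdot> Proj1 C A X \<oplus>
        partial2 C (A \<boxtimes> X) A F (Proj1 C A X) (z \<cdot> Proj1 C A X) (Proj2 C A X)"
  show "repetition C A X F z b = Fix C A X ?G" by (simp add: repetition_def)
  show "?G \<cdot> \<langle>Id C A, y\<rangle> = b \<oplus> partial2 C A A F (Id C A) z y"
    if "arr y" "src y = A" "tgt y = X" for y
    using assms that by (simp add: partial2_def)
qed (use assms in simp_all)

lemma repetition_typing [simp]:
  assumes "arr F" "src F = A \<boxtimes> X" "tgt F = X" "arr z" "src z = A" "tgt z = X"
    "arr b" "src b = A" "tgt b = X"
  shows "arr (repetition C A X F z b)" "src (repetition C A X F z b) = A"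
    "tgt (repetition C A X F z b) = X"
  by (rule repetition_eq_Fix[OF assms]; simp)+

lemma repetition_unfold:
  assumes "arr F" "src F = A \<boxtimes> X" "tgt F = X" "arr z" "src z = A" "tgt z = X"
    "arr b" "src b = A" "tgt b = X"
  shows "repetition C A X F z b = b \<oplus> partial2 C A A F (Id C A) z (repetition C A X F z b)"
  by (rule repetition_eq_Fix[OF assms]) (metis Fix_unfold Fix_typing)

text \<open>
  Both invariants of the iteration, and the comparison with one Kleene step. All three come from
  \<open>z \<oplus> (\<delta> \<oplus> D y) = F(z) \<oplus> D y \<sqsubseteq> F(z \<oplus> y)\<close>, where \<open>D\<close> is the partial derivative at \<open>z\<close>: taken at \<open>y = s\<close>
  it gives the postfixpoint property, since \<open>s = \<delta> \<oplus> D s\<close>; taken at the iterates that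
  approximate \<open>s\<close>, it keeps them below the fixpoint.
\<close>

lemma newton_step:
  fixes A X F z
  defines "\<delta> \<equiv> monus C A X (F \<cdot> \<langle>Id C A, z\<rangle>) z"
  defines "s \<equiv> repetition C A X F z \<delta>"
  assumes F: "arr F" "src F = A \<boxtimes> X" "tgt F = X" and z: "arr z" "src z = A" "tgt z = X"
    and post: "z \<sqsubseteq> F \<cdot> \<langle>Id C A, z\<rangle>" and below: "z \<sqsubseteq> Fix C A X F"
  shows "F \<cdot> \<langle>Id C A, z\<rangle> \<sqsubseteq> z \<oplus> s" "z \<oplus> s \<sqsubseteq> F \<cdot> \<langle>Id C A, z \<oplus> s\<rangle>" "z \<oplus> s \<sqsubseteq> Fix C A X F"
proof -
  let ?u = "Fix C A X F" and ?D = "partial2 C A A F (Id C A) z"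
  have d: "arr \<delta>" "src \<delta> = A" "tgt \<delta> = X"
    using F z by (simp_all add: \<delta>_def)
  have s: "arr s" "src s = A" "tgt s = X"
    using F z d by (simp_all add: s_def)
  have zd: "z \<oplus> \<delta> = F \<cdot> \<langle>Id C A, z\<rangle>"
    unfolding \<delta>_def using F z post by (intro Plus_monus) auto
  have below_F: "z \<oplus> (\<delta> \<oplus> ?D y) \<sqsubseteq> F \<cdot> \<langle>Id C A, z \<oplus> y\<rangle>" if y: "arr y" "src y = A" "tgt y = X" for y
  proof -
    obtain R where R: "arr R" "src R = A" "tgt R = tgt F"
      "F \<cdot> \<langle>Id C A, z \<oplus> y\<rangle> = (F \<cdot> \<langle>Id C A, z\<rangle> \<oplus> ?D y) \<oplus> R"
      by (rule taylor_second_order_snd[of F A X z y]) (use F z y in auto)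
    have "z \<oplus> (\<delta> \<oplus> ?D y) = F \<cdot> \<langle>Id C A, z\<rangle> \<oplus> ?D y"
      using F z d y by (simp add: Plus_monoid(1) flip: zd)
    then show ?thesis
      unfolding R(4) using F z y R(1-3) by (simp add: le_add)
  qed
  have s_eq: "s = \<delta> \<oplus> ?D s"
    unfolding s_def using F z d by (intro repetition_unfold) auto
  show "F \<cdot> \<langle>Id C A, z\<rangle> \<sqsubseteq> z \<oplus> s"
  proof -
    have "z \<oplus> s = (z \<oplus> \<delta>) \<oplus> ?D s"
      using F z d s by (subst s_eq) (simp add: Plus_monoid(1))
    then show ?thesis using F z d s by (simp add: zd le_add)
  qed
  show "z \<oplus> s \<sqsubseteq> F \<cdot> \<langle>Id C A, z \<oplus> s\<rangle>"
    using below_F[OF s] s_eq by simp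
  obtain G where G: "arr G" "src G = A \<boxtimes> X" "tgt G = X" "s = Fix C A X G"
    "\<And>y. arr y \<Longrightarrow> src y = A \<Longrightarrow> tgt y = X \<Longrightarrow> G \<cdot> \<langle>Id C A, y\<rangle> = \<delta> \<oplus> ?D y"
    unfolding s_def by (rule repetition_eq_Fix[OF F z d]) blast
  let ?k = "kleene A X G"
  have k: "arr (?k n)" "src (?k n) = A" "tgt (?k n) = X" for n
    using G by simp_all
  have "z \<oplus> ?k n \<sqsubseteq> ?u" for n
  proof (induction n)
    case 0
    then show ?case using z below by simp
  next
    case (Suc n)
    have "z \<oplus> ?k (Suc n) = z \<oplus> (\<delta> \<oplus> ?D (?k n))"
      using G(5)[OF k] by simp
    moreover have "F \<cdot> \<langle>Id C A, z \<oplus> ?k n\<rangle> \<sqsubseteq> F \<cdot> \<langle>Id C A, ?u\<rangle>"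
      using F z k Suc.IH by (intro Comp_mono Pair_mono le_refl) auto
    ultimately show ?case
      using le_trans[OF below_F[OF k[of n]]] Fix_unfold[OF F] by metis
  qed
  then show "z \<oplus> s \<sqsubseteq> ?u"
    using sup_least[OF Plus_continuous[OF sup_const[OF z] Fix_sup_kleene[OF G(1-3)]]] G(4) by simp
qed

lemma newton_invariants:
  assumes "arr F" "src F = A \<boxtimes> X" "tgt F = X"
  shows "arr (newton_approx C A X F n) \<and> src (newton_approx C A X F n) = A \<and>
    tgt (newton_approx C A X F n) = X \<and>
    newton_approx C A X F n \<sqsubseteq> F \<cdot> \<langle>Id C A, newton_approx C A X F n\<rangle> \<and>
    newton_approx C A X F n \<sqsubseteq> Fix C A X F"
proof (induction n)
  case 0
  then show ?case
    using assms Zero_bottom[of "F \<cdot> \<langle>Id C A, Zero C A X\<rangle>" A X] Zero_bottom[of "Fix C A X F" A X]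
    by (simp add: in_Hom_iff)
next
  case (Suc n)
  let ?z = "newton_approx C A X F n"
  have z: "arr ?z" "src ?z = A" "tgt ?z = X" using Suc.IH by auto
  show ?case
    using newton_step(2,3)[OF assms z] Suc.IH assms z by (simp add: Let_def)
qed

lemma newton_approx_typing [simp]:
  assumes "arr F" "src F = A \<boxtimes> X" "tgt F = X"
  shows "arr (newton_approx C A X F n)" "src (newton_approx C A X F n) = A"
    "tgt (newton_approx C A X F n) = X"
  using newton_invariants[OF assms] by auto

lemma newton_chain:
  assumes "arr F" "src F = A \<boxtimes> X" "tgt F = X"
  shows "is_omega_chain C A X (newton_approx C A X F)"
  using assms by (intro chainI) (auto simp: Let_def intro!: le_add)

text \<open>
  A Newton step gains at least as much as a Kleene step, so the Newton approximants dominate the Kleene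
  iterates while staying below the fixpoint.
\<close>

lemma newton_sup:
  assumes "arr F" "src F = A \<boxtimes> X" "tgt F = X"
  shows "is_omega_sup C A X (newton_approx C A X F) (Fix C A X F)"
proof (rule supI[OF newton_chain[OF assms]])
  let ?z = "newton_approx C A X F"
  have z: "arr (?z n)" "src (?z n) = A" "tgt (?z n) = X" "?z n \<sqsubseteq> F \<cdot> \<langle>Id C A, ?z n\<rangle>"
    "?z n \<sqsubseteq> Fix C A X F" for n
    using newton_invariants[OF assms, of n] by auto
  show "?z n \<sqsubseteq> Fix C A X F" for n by (rule z)
  fix v assume v: "\<And>n. ?z n \<sqsubseteq> v"
  have "kleene A X F n \<sqsubseteq> ?z n" for n
  proof (induction n)
    case (Suc n)
    have "F \<cdot> \<langle>Id C A, kleene A X F n\<rangle> \<sqsubseteq> F \<cdot> \<langle>Id C A, ?z n\<rangle>"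
      using assms Suc.IH by (intro Comp_mono Pair_mono le_refl) auto
    then show ?case
      using le_trans[OF _ newton_step(1)[OF assms z]] by (simp add: Let_def)
  qed (simp add: le_refl)
  then show "Fix C A X F \<sqsubseteq> v"
    using sup_least[OF Fix_sup_kleene[OF assms]] le_trans[OF _ v] by blast
qed (use assms in simp_all)

section \<open>Quadratic convergence\<close>

text \<open>
  The error \<open>h\<close> and the Newton correction \<open>s\<close> obey the recursions \<open>h \<mapsto> \<delta> \<oplus> D h \<oplus> R\<close> and
  \<open>s = \<delta> \<oplus> D s\<close>, which differ only by the second order remainder. Unfolding both \<open>j\<close> times produces
  the same \<open>P\<close>, the sum of the first \<open>j\<close> terms \<open>D\<^sup>i \<delta>\<close>, and collects the remainders in \<open>E\<close>. The order of
  the whole error is carried along because it controls the next remainder.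
\<close>

lemma newton_error_expansion:
  fixes A X F z
  defines "\<delta> \<equiv> monus C A X (F \<cdot> \<langle>Id C A, z\<rangle>) z"
  defines "s \<equiv> repetition C A X F z \<delta>"
  defines "D \<equiv> partial2 C A A F (Id C A) z"
  assumes F: "arr F" "src F = A \<boxtimes> X" "tgt F = X" and z: "arr z" "src z = A" "tgt z = X"
    and post: "z \<sqsubseteq> F \<cdot> \<langle>Id C A, z\<rangle>"
    and h: "arr h" "src h = A" "tgt h = X" "z \<oplus> h = Fix C A X F" "vanishes k (Id C A) h"
  shows "\<exists>P E. arr P \<and> src P = A \<and> tgt P = X \<and> arr E \<and> src E = A \<and> tgt E = X \<and>
    z \<oplus> ((P \<oplus> (D ^^ j) h) \<oplus> E) = Fix C A X F \<and> vanishes k (Id C A) ((P \<oplus> (D ^^ j) h) \<oplus> E) \<and>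
    vanishes (2 * k) (Id C A) E \<and> s = P \<oplus> (D ^^ j) s"
proof -
  let ?u = "Fix C A X F" and ?van = "\<lambda>n. vanishes n (Id C A)"
  have d: "arr \<delta>" "src \<delta> = A" "tgt \<delta> = X"
    using F z by (simp_all add: \<delta>_def)
  have s: "arr s" "src s = A" "tgt s = X"
    using F z d by (simp_all add: s_def)
  have D: "arr (D y)" "src (D y) = A" "tgt (D y) = X" if "arr y" "src y = A" "tgt y = X" for y
    using F z that by (simp_all add: D_def)
  have D_Plus: "D (x \<oplus> y) = D x \<oplus> D y"
    if "arr x" "src x = A" "tgt x = X" "arr y" "src y = A" "tgt y = X" for x y
    unfolding D_def using F z that by (intro partial2_Plus) auto
  have Dj: "arr ((D ^^ j) y)" "src ((D ^^ j) y) = A" "tgt ((D ^^ j) y) = X"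
    if "arr y" "src y = A" "tgt y = X" for y j
    using that by (induction j) (simp_all add: D)
  have s_eq: "s = \<delta> \<oplus> D s"
    unfolding s_def D_def using F z d by (intro repetition_unfold) auto
  have zd: "z \<oplus> \<delta> = F \<cdot> \<langle>Id C A, z\<rangle>"
    unfolding \<delta>_def using F z post by (intro Plus_monus) auto
  have van_\<delta>: "?van k \<delta>"
  proof (rule vanishes_le[OF _ h(5)])
    have "z \<sqsubseteq> ?u" using le_add[of z h] z h by simp
    then have "F \<cdot> \<langle>Id C A, z\<rangle> \<sqsubseteq> F \<cdot> \<langle>Id C A, ?u\<rangle>"
      using F z by (intro Comp_mono Pair_mono le_refl) auto
    then have "F \<cdot> \<langle>Id C A, z\<rangle> \<sqsubseteq> z \<oplus> h"
      using Fix_unfold[OF F] h(4) by simp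
    then show "\<delta> \<sqsubseteq> h"
      unfolding \<delta>_def using F z h by (subst monus_le_iff) auto
  qed (use d in auto)
  show ?thesis
  proof (induction j)
    case 0
    have "arr (Zero C A X)" "src (Zero C A X) = A" "tgt (Zero C A X) = X" "?van (2 * k) (Zero C A X)"
      by (auto intro!: vanishes_Zero)
    then show ?case
      using h s by (intro exI[of _ "Zero C A X"]) auto
  next
    case (Suc j)
    then obtain P E where P: "arr P" "src P = A" "tgt P = X" and E: "arr E" "src E = A" "tgt E = X"
      and sum: "z \<oplus> ((P \<oplus> (D ^^ j) h) \<oplus> E) = ?u" and van: "?van k ((P \<oplus> (D ^^ j) h) \<oplus> E)"
      and van_E: "?van (2 * k) E" and s_P: "s = P \<oplus> (D ^^ j) s"
      by blast
    define g where "g = (D ^^ j) h"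
    define t where "t = (D ^^ j) s"
    have g: "arr g" "src g = A" "tgt g = X" and t: "arr t" "src t = A" "tgt t = X"
      using Dj[OF h(1-3), of j] Dj[OF s, of j] by (simp_all add: g_def t_def)
    note typing = d P E g t D[OF P] D[OF E] D[OF g] D[OF t]
    let ?h = "(P \<oplus> g) \<oplus> E"
    have hs: "arr ?h" "src ?h = A" "tgt ?h = X" using typing by simp_all
    obtain R where R: "arr R" "src R = A" "tgt R = tgt F"
      "F \<cdot> \<langle>Id C A, z \<oplus> ?h\<rangle> = (F \<cdot> \<langle>Id C A, z\<rangle> \<oplus> D ?h) \<oplus> R"
      "\<And>k. ?van k ?h \<Longrightarrow> ?van (2 * k) R"
      unfolding D_def
      by (rule taylor_second_order_snd[of F A X z ?h]) (use F z hs in auto)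
    \<comment> \<open>the new error \<open>\<delta> \<oplus> D ?h \<oplus> R\<close>, sorted into the two parts\<close>
    let ?P = "\<delta> \<oplus> D P" and ?E = "D E \<oplus> R"
    have split: "\<delta> \<oplus> (D ?h \<oplus> R) = (?P \<oplus> D g) \<oplus> ?E"
      using typing R(1-3) F by (simp add: D_Plus Plus_monoid(1))
    have "?u = F \<cdot> \<langle>Id C A, z \<oplus> ?h\<rangle>"
      using Fix_unfold[OF F] sum by (simp add: g_def)
    also have "\<dots> = z \<oplus> (\<delta> \<oplus> (D ?h \<oplus> R))"
      unfolding R(4) zd[symmetric] using z d D[OF hs] R(1-3) F by (simp add: Plus_monoid(1))
    finally have u_eq: "z \<oplus> ((?P \<oplus> D g) \<oplus> ?E) = ?u"
      unfolding split by simp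
    have van_D: "?van n (D y)" if "?van n y" "arr y" "src y = A" "tgt y = X" for n y
      unfolding D_def using F z that by (intro vanishes_partial2) auto
    have van_h: "?van k ?h" using van by (simp add: g_def)
    have van_R: "?van (2 * k) R" by (rule R(5)[OF van_h])
    have "?van k (\<delta> \<oplus> (D ?h \<oplus> R))"
      using D[OF hs] d R(1-3) F
      by (intro vanishes_Plus van_\<delta> van_D van_h hs vanishes_mono[OF van_R]) auto
    moreover have "?van (2 * k) ?E"
      using typing E R(1-3) F by (intro vanishes_Plus van_D van_E van_R) auto
    moreover have "s = ?P \<oplus> D t"
    proof -
      have "s = \<delta> \<oplus> D (P \<oplus> t)" using s_eq s_P by (simp add: t_def)
      then show ?thesis using typing by (simp add: D_Plus Plus_monoid(1))
    qed
    moreover have "D g = (D ^^ Suc j) h" "D t = (D ^^ Suc j) s"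
      by (simp_all add: g_def t_def)
    ultimately show ?case
      using typing R(1-3) F u_eq unfolding split by (intro exI[of _ ?P] exI[of _ ?E]) simp
  qed
qed

text \<open>
  Unfolding until the power of the derivative is zero leaves \<open>s = P\<close>, so the error of the approximant
  \<open>z \<oplus> s\<close> is the second order part \<open>E\<close> alone.
\<close>

lemma newton_doubles_agreement:
  assumes F: "arr F" "src F = A \<boxtimes> X" "tgt F = X" and nil: "nilpotent_partial2 C A X F"
    and agree: "\<And>i. i < k \<Longrightarrow>
      taylor_monomial C A i (newton_approx C A X F n) = taylor_monomial C A i (Fix C A X F)"
    and "i < 2 * k"
  shows "taylor_monomial C A i (newton_approx C A X F (Suc n)) = taylor_monomial C A i (Fix C A X F)"
proof -
  let ?z = "newton_approx C A X F n" and ?u = "Fix C A X F"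
  let ?\<delta> = "monus C A X (F \<cdot> \<langle>Id C A, ?z\<rangle>) ?z"
  let ?s = "repetition C A X F ?z ?\<delta>" and ?D = "partial2 C A A F (Id C A) ?z"
  have z: "arr ?z" "src ?z = A" "tgt ?z = X" and post: "?z \<sqsubseteq> F \<cdot> \<langle>Id C A, ?z\<rangle>" and "?z \<sqsubseteq> ?u"
    using newton_invariants[OF F, of n] by auto
  have s: "arr ?s" "src ?s = A" "tgt ?s = X" using F z by simp_all
  obtain h0 where h0: "arr h0" "src h0 = A" "tgt h0 = X" "?u = ?z \<oplus> h0"
    using leE[OF \<open>?z \<sqsubseteq> ?u\<close>] unfolding z by metis
  obtain h where h: "arr h" "src h = A" "tgt h = X" "?z \<oplus> h = ?u" "vanishes k (Id C A) h"
  proof (rule high_order_difference[of ?z h0 A X k])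
    show "taylor_monomial C A i ?z = taylor_monomial C A i (?z \<oplus> h0)" if "i < k" for i
      using agree[OF that] unfolding h0(4) .
  qed (use z h0 in auto)
  obtain p where "\<forall>Z. \<forall>a \<in> Hom C Z A. \<forall>z \<in> Hom C Z X. \<forall>b \<in> Hom C Z X.
      (partial2 C Z A F a z ^^ p) b = Zero C Z X"
    using nil unfolding nilpotent_partial2_def by blast
  then have p: "(?D ^^ p) b = Zero C A X" if "arr b" "src b = A" "tgt b = X" for b
    using z that by (simp add: in_Hom_iff)
  obtain P E where P: "arr P" "src P = A" "tgt P = X" and E: "arr E" "src E = A" "tgt E = X"
    and sum: "?z \<oplus> ((P \<oplus> (?D ^^ p) h) \<oplus> E) = ?u"
    and van: "vanishes (2 * k) (Id C A) E" and s_P: "?s = P \<oplus> (?D ^^ p) ?s"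
    using newton_error_expansion[OF F z post h, of p] by blast
  have "?s = P" using s_P p[OF s] P by simp
  then have "?u = newton_approx C A X F (Suc n) \<oplus> E"
    using sum p[OF h(1-3)] P E z by (simp add: Let_def Plus_monoid(1))
  moreover have "arr (newton_approx C A X F (Suc n))" "src (newton_approx C A X F (Suc n)) = A"
    "tgt (newton_approx C A X F (Suc n)) = X"
    using newton_approx_typing[OF F] by blast+
  ultimately show ?thesis
    using taylor_monomial_vanishes[OF van _ _ assms(6)] E
    by (simp add: taylor_monomial_Plus del: newton_approx.simps)
qed

text \<open>
  Agreement below degree \<open>k\<close> means distance at most \<open>2\<close> to the power \<open>-k\<close>. The hypothesis for arbitrarily
  large \<open>k\<close> also covers distance zero.
\<close>

lemma taylor_dist_le_square:
  assumes "\<And>k i. (\<And>j. j < k \<Longrightarrow> taylor_monomial C A j f = taylor_monomial C A j u)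
    \<Longrightarrow> i < 2 * k \<Longrightarrow> taylor_monomial C A i g = taylor_monomial C A i u"
  shows "taylor_dist C A g u \<le> (taylor_dist C A f u)\<^sup>2"
proof -
  define P where "P = (\<lambda>i. taylor_monomial C A i f \<noteq> taylor_monomial C A i u)"
  define Q where "Q = (\<lambda>i. taylor_monomial C A i g \<noteq> taylor_monomial C A i u)"
  have step: "\<not> Q i" if "\<And>j. j < k \<Longrightarrow> \<not> P j" "i < 2 * k" for k i
    using assms[of k i] that unfolding P_def Q_def by blast
  have dist: "taylor_dist C A f u = (if \<exists>i. P i then 1 / 2 ^ (LEAST i. P i) else 0)"
    "taylor_dist C A g u = (if \<exists>i. Q i then 1 / 2 ^ (LEAST i. Q i) else 0)"
    unfolding taylor_dist_def P_def Q_def by (rule refl)+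
  show ?thesis
  proof (cases "\<exists>i. Q i")
    case True
    then have Q: "Q (LEAST i. Q i)" by (rule LeastI_ex)
    have "\<exists>i. P i"
      using step[of "Suc (LEAST i. Q i)" "LEAST i. Q i"] Q by fastforce
    moreover have le: "2 * (LEAST i. P i) \<le> (LEAST i. Q i)"
      using step[of "LEAST i. P i" "LEAST i. Q i"] Q not_less_Least[of _ P] not_le by blast
    have "(1::real) / 2 ^ (LEAST i. Q i) \<le> 1 / 2 ^ (2 * (LEAST i. P i))"
      using power_increasing[OF le, of "2 :: real"] by (intro divide_left_mono) auto
    then have "(1::real) / 2 ^ (LEAST i. Q i) \<le> (1 / 2 ^ (LEAST i. P i))\<^sup>2"
      by (simp only: power_even_eq power_divide power_one)
    ultimately show ?thesis
      using True unfolding dist by (simp only: if_True)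
  qed (simp add: dist)
qed

lemma newton_quadratic:
  assumes "arr F" "src F = A \<boxtimes> X" "tgt F = X" "nilpotent_partial2 C A X F"
  shows "taylor_dist C A (newton_approx C A X F (Suc n)) (Fix C A X F)
    \<le> (taylor_dist C A (newton_approx C A X F n) (Fix C A X F))\<^sup>2"
proof (rule taylor_dist_le_square)
  fix k i
  assume "\<And>j. j < k \<Longrightarrow>
    taylor_monomial C A j (newton_approx C A X F n) = taylor_monomial C A j (Fix C A X F)"
    and "i < 2 * k"
  then show "taylor_monomial C A i (newton_approx C A X F (Suc n))
      = taylor_monomial C A i (Fix C A X F)"
    by (rule newton_doubles_agreement[OF assms])
qed

end

theorem theorem8p2:
  fixes C :: "('o, 'm) dcat" (structure)
  assumes "newton_category C"
  shows "(\<forall>A. is_omega_chain C (A \<rightarrowtail> A) A (newton_comb C A) \<and>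
              is_omega_sup C (A \<rightarrowtail> A) A (newton_comb C A)
                (omega_sup C (A \<rightarrowtail> A) A (newton_comb C A)) \<and>
              omega_sup C (A \<rightarrowtail> A) A (newton_comb C A) = fix_comb C A \<and>
              (\<forall>n. newton_comb C A n \<sqsubseteq> fix_comb C A)) \<and>
         (\<forall>A X. \<forall>f \<in> Hom C (A \<boxtimes> X) X.
            f \<cdot> \<langle>Zero C (One C) A, Zero C (One C) X\<rangle> = Zero C (One C) X \<longrightarrow>
            nilpotent_partial2 C A X f \<longrightarrow>
            (\<forall>n. taylor_dist C A (newton_approx C A X f (Suc n)) (Fix C A X f)
                 \<le> (taylor_dist C A (newton_approx C A X f n) (Fix C A X f))\<^sup>2))"
proof -
  interpret newton_category C by (rule assms)
  have sup: "is_omega_sup C (A \<rightarrowtail> A) A (newton_comb C A) (fix_comb C A)" for A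
    unfolding newton_comb_def fix_comb_def by (rule newton_sup) simp_all
  have quadratic: "taylor_dist C A (newton_approx C A X f (Suc n)) (Fix C A X f)
      \<le> (taylor_dist C A (newton_approx C A X f n) (Fix C A X f))\<^sup>2"
    if "f \<in> Hom C (A \<boxtimes> X) X" "nilpotent_partial2 C A X f" for A X f n
    using that by (intro newton_quadratic) (auto simp: in_Hom_iff)
  show ?thesis
    using sup sup_typing(1,5)[OF sup] quadratic by (simp add: omega_sup_eq[OF sup] del: newton_approx.simps)
qed

end
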